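(* Let $\mathbb{K}\in\{\mathbb{R},\mathbb{C}\}$ and let $f\in\mathbb{K}[x_1,\ldots,x_n]$ be a homogeneous polynomial of degree 3 with slices $S_1,\ldots,S_n$. Consider the following deterministic procedure: (1) Pick an arbitrary set $M$ of $n(n-1)+1$ distinct points on the moment curve $\gamma(t)=(1,t,t^2,\ldots,t^{n-1})$. (2) Enumerate $M$ to find a point $r=(1,r_2,\ldots,r_n)\in M$ such that $D_1=S_1+r_2S_2+\cdots+r_nS_n$ is invertible. If there is no such point, reject. (3) Construct the lower triangular matrix $R\in M_n(\mathbb{K})$ with 1's on the diagonal, $R_{21}=r_2,\ldots,R_{n1}=r_n$, and all other entries 0. (4) Compute $h(x)=f(Rx)$, the slices $T_1,\ldots,T_n$ of $h$, and $T_1'=T_1^{-1}$. (5) If the matrices $T_1'T_k$ ($k=2,\ldots,n$) pairwise commute and are all diagonalizable over $\mathbb{K}$, accept; otherwise reject. Then $f$ is accepted by this procedure if and only if $f$ is equivalent over $\mathbb{K}$ to a sum of $n$ cubes.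
   Context: A homogeneous polynomial $f\in\mathbb{K}[x_1,\ldots,x_n]$ of degree 3 is equivalent (over $\mathbb{K}$) to a sum of $n$ cubes if $f(x)=P_3(Ax)$ for some nonsingular $A\in M_n(\mathbb{K})$, where $P_3(x_1,\ldots,x_n)=x_1^3+\cdots+x_n^3$. The slices of a degree 3 form $g$: let $T_{ijk}=\frac16\,\partial^3 g/\partial x_i\partial x_j\partial x_k$; the $i$-th slice of $g$ is the symmetric $n\times n$ matrix $T_i$ with $(T_i)_{jk}=T_{ijk}$. *)

theory Defs
  imports Complex_Main "HOL-Library.Poly_Mapping" "Jordan_Normal_Form.Gauss_Jordan_Elimination"
begin

text \<open>Polynomials are finitely supported maps from monomials to coefficients, a monomial being a
  finitely supported map from variable indices to exponents; the ring structure is the one of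
  Poly_Mapping. All indices start at 0, so the variables \<open>x\<^sub>1, \<dots>, x\<^sub>n\<close> have the indices
  \<open>0, \<dots>, n - 1\<close>; likewise for slices, vectors and matrices.\<close>

type_synonym 'a mpoly = "(nat \<Rightarrow>\<^sub>0 nat) \<Rightarrow>\<^sub>0 'a"

definition pconst :: "'a::zero \<Rightarrow> 'a mpoly" where
  "pconst c = Poly_Mapping.single 0 c"

definition pvar :: "nat \<Rightarrow> 'a::zero_neq_one mpoly" where
  "pvar i = Poly_Mapping.single (Poly_Mapping.single i 1) 1"

definition polys_in :: "nat \<Rightarrow> 'a::zero mpoly set" where
  "polys_in n = {p. \<forall>m\<in>Poly_Mapping.keys p. Poly_Mapping.keys m \<subseteq> {..<n}}"

definition mono_degree :: "(nat \<Rightarrow>\<^sub>0 nat) \<Rightarrow> nat" where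
  "mono_degree m = (\<Sum>i\<in>Poly_Mapping.keys m. Poly_Mapping.lookup m i)"

text \<open>The zero polynomial is homogeneous of every degree.\<close>

definition homogeneous :: "nat \<Rightarrow> 'a::zero mpoly \<Rightarrow> bool" where
  "homogeneous d p \<longleftrightarrow> (\<forall>m\<in>Poly_Mapping.keys p. mono_degree m = d)"

definition subst_poly :: "(nat \<Rightarrow> 'a mpoly) \<Rightarrow> 'a::comm_ring_1 mpoly \<Rightarrow> 'a mpoly" where
  "subst_poly \<sigma> p = (\<Sum>m\<in>Poly_Mapping.keys p. pconst (Poly_Mapping.lookup p m) *
     (\<Prod>i\<in>Poly_Mapping.keys m. \<sigma> i ^ Poly_Mapping.lookup m i))"

text \<open>The polynomial \<open>p(Ax)\<close>. It is meaningful if the variables of \<open>p\<close> have indices below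
  \<open>dim_row A\<close>.\<close>

definition lin_subst :: "'a::comm_ring_1 mat \<Rightarrow> 'a mpoly \<Rightarrow> 'a mpoly" where
  "lin_subst A p = subst_poly (\<lambda>i. \<Sum>j<dim_col A. pconst (A $$ (i, j)) * pvar j) p"

text \<open>The truncated subtraction on exponents is harmless: for a monomial not containing \<open>x\<^sub>i\<close> the
  coefficient is 0.\<close>

definition partial_deriv :: "nat \<Rightarrow> 'a::comm_ring_1 mpoly \<Rightarrow> 'a mpoly" where
  "partial_deriv i p = (\<Sum>m\<in>Poly_Mapping.keys p.
     Poly_Mapping.single (m - Poly_Mapping.single i 1)
       (of_nat (Poly_Mapping.lookup m i) * Poly_Mapping.lookup p m))"

definition sum_of_cubes :: "nat \<Rightarrow> 'a::comm_ring_1 mpoly" where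
  "sum_of_cubes n = (\<Sum>i<n. pvar i ^ 3)"

definition equiv_sum_of_cubes :: "nat \<Rightarrow> 'a::comm_ring_1 mpoly \<Rightarrow> bool" where
  "equiv_sum_of_cubes n f \<longleftrightarrow>
     (\<exists>A\<in>carrier_mat n n. invertible_mat A \<and> f = lin_subst A (sum_of_cubes n))"

text \<open>The third partial derivatives of a form of degree 3 are constant polynomials; the
  corresponding scalar is their coefficient at the monomial 1.\<close>

definition slice :: "nat \<Rightarrow> 'a::field_char_0 mpoly \<Rightarrow> nat \<Rightarrow> 'a mat" where
  "slice n g i = mat n n (\<lambda>(j, k).
     1 / 6 * Poly_Mapping.lookup (partial_deriv i (partial_deriv j (partial_deriv k g))) 0)"

definition diagonalizable_mat :: "'a::semiring_1 mat \<Rightarrow> bool" where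
  "diagonalizable_mat A \<longleftrightarrow> (\<exists>D. diagonal_mat D \<and> similar_mat A D)"

definition moment_curve :: "nat \<Rightarrow> 'a::semiring_1 \<Rightarrow> 'a vec" where
  "moment_curve n t = vec n (\<lambda>i. t ^ i)"

text \<open>\<open>S\<^sub>1 + r\<^sub>2 S\<^sub>2 + \<dots> + r\<^sub>n S\<^sub>n\<close>\<close>

definition slice_comb :: "nat \<Rightarrow> 'a::field_char_0 mpoly \<Rightarrow> 'a vec \<Rightarrow> 'a mat" where
  "slice_comb n f r =
     slice n f 0 + mat n n (\<lambda>jk. \<Sum>i = 1..<n. r $ i * slice n f i $$ jk)"

definition change_mat :: "nat \<Rightarrow> 'a::semiring_1 vec \<Rightarrow> 'a mat" where
  "change_mat n r = mat n n (\<lambda>(i, j). if i = j then 1 else if j = 0 then r $ i else 0)"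

text \<open>The procedure; the list \<open>ms\<close> is the enumeration of the set \<open>M\<close>. Whenever the inverse is
  taken, \<open>T 0\<close> is invertible, as it equals \<open>R\<^sup>T D\<^sub>1 R\<close> for the invertible matrix \<open>D\<^sub>1\<close>.\<close>

definition accepts :: "nat \<Rightarrow> 'a::field_char_0 vec list \<Rightarrow> 'a mpoly \<Rightarrow> bool" where
  "accepts n ms f \<longleftrightarrow>
     (case find (\<lambda>r. invertible_mat (slice_comb n f r)) ms of
        None \<Rightarrow> False
      | Some r \<Rightarrow>
          (let R = change_mat n r;
               h = lin_subst R f;
               T = slice n h;
               T1' = the (mat_inverse (T 0))
           in (\<forall>k\<in>{1..<n}. \<forall>l\<in>{1..<n}. (T1' * T k) * (T1' * T l) = (T1' * T l) * (T1' * T k)) \<and>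
              (\<forall>k\<in>{1..<n}. diagonalizable_mat (T1' * T k))))"

end

theory Submission
  imports Defs "Jordan_Normal_Form.Determinant"
begin

text \<open>A cubic form is the same thing as a symmetric tensor, and it is equivalent to a sum of cubes iff
  its slices are \<open>S\<^sub>k = A\<^sup>T diag(A\<^sub>1\<^sub>k, \<dots>, A\<^sub>n\<^sub>k) A\<close> for some invertible \<open>A\<close>. In that case \<open>D\<^sub>1\<close> is
  congruent to the diagonal matrix with entries \<open>(Ar)\<^sub>l\<close>, which vanish for at most \<open>n (n - 1)\<close> points of
  the moment curve, and the matrices \<open>T\<^sub>1\<inverse> T\<^sub>k\<close> are diagonalized by \<open>AR\<close>. Conversely, let the columns of
  \<open>Q\<close> be a basis of joint eigenvectors of the matrices \<open>T\<^sub>1\<inverse> T\<^sub>k\<close> and \<open>W = T\<^sub>1 Q\<close>. The symmetry of the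
  tensor forces column \<open>b\<close> of \<open>W\<close> to be a multiple of the tuple of eigenvalues of column \<open>b\<close> of \<open>Q\<close>, so
  the tuples are distinct and \<open>Q\<^sup>T T\<^sub>1 Q\<close> is diagonal. Hence the tensor is
  \<open>\<Sum>\<^sub>b d\<^sub>b w\<^sub>b \<otimes> w\<^sub>b \<otimes> w\<^sub>b\<close> with \<open>w\<^sub>b\<close> the columns of \<open>W\<close>, and cube roots of the \<open>d\<^sub>b\<close> give the matrix
  \<open>A\<close>.\<close>

subsection \<open>Cubic forms and symmetric tensors\<close>

definition mono3 :: "nat \<Rightarrow> nat \<Rightarrow> nat \<Rightarrow> (nat \<Rightarrow>\<^sub>0 nat)" where
  "mono3 i j k = Poly_Mapping.single i 1 + Poly_Mapping.single j 1 + Poly_Mapping.single k 1"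

text \<open>Summing over all ordered triples, without multinomial factors, makes a symmetric
  \<open>t\<close> itself the tensor of slices of the form.\<close>

definition cubic :: "nat \<Rightarrow> (nat \<Rightarrow> nat \<Rightarrow> nat \<Rightarrow> 'a::comm_ring_1) \<Rightarrow> 'a mpoly" where
  "cubic n t = (\<Sum>i<n. \<Sum>j<n. \<Sum>k<n. Poly_Mapping.single (mono3 i j k) (t i j k))"

definition symmetric3 :: "nat \<Rightarrow> (nat \<Rightarrow> nat \<Rightarrow> nat \<Rightarrow> 'a) \<Rightarrow> bool" where
  "symmetric3 n t \<longleftrightarrow> (\<forall>i<n. \<forall>j<n. \<forall>k<n. t i j k = t j i k \<and> t i j k = t i k j)"

lemma lookup_mono3:
  "Poly_Mapping.lookup (mono3 i j k) a = of_bool (i = a) + of_bool (j = a) + of_bool (k = a)"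
  by (auto simp: mono3_def lookup_add lookup_single when_def)

lemma single_add_single_eq_iff:
  "Poly_Mapping.single b 1 + Poly_Mapping.single c 1 =
     Poly_Mapping.single j 1 + Poly_Mapping.single k (1 :: nat) \<longleftrightarrow>
   b = j \<and> c = k \<or> b = k \<and> c = j" (is "?l = ?r \<longleftrightarrow> _")
proof
  assume "?l = ?r"
  then have "Poly_Mapping.lookup ?l x = Poly_Mapping.lookup ?r x" for x
    by simp
  from this[of b] this[of c] show "b = j \<and> c = k \<or> b = k \<and> c = j"
    by (cases "b = c"; cases "b = j"; cases "b = k"; cases "c = j"; cases "c = k")
      (simp_all add: lookup_add lookup_single)
qed (auto simp: ac_simps)

text \<open>The variable \<open>a\<close> must occur in the other monomial, so it is one of
  \<open>i\<close>, \<open>j\<close>, \<open>k\<close>; cancelling it leaves an equation between two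
  products of two variables.\<close>

lemma mono3_eq_iff:
  "mono3 a b c = mono3 i j k \<longleftrightarrow>
     (a, b, c) \<in> {(i, j, k), (i, k, j), (j, i, k), (j, k, i), (k, i, j), (k, j, i)}"
proof
  assume eq: "mono3 a b c = mono3 i j k"
  have swap: "mono3 i j k = mono3 j i k" "mono3 i j k = mono3 k i j"
    by (simp_all add: mono3_def ac_simps)
  have cancel: "b = x \<and> c = y \<or> b = y \<and> c = x" if "mono3 a b c = mono3 a x y" for x y
    using that single_add_single_eq_iff[of b c x y] by (simp add: mono3_def add.assoc)
  have "Poly_Mapping.lookup (mono3 i j k) a \<noteq> 0"
    unfolding eq[symmetric] by (simp add: lookup_mono3)
  then consider "a = i" | "a = j" | "a = k"
    by (auto simp: lookup_mono3)
  then show "(a, b, c) \<in> {(i, j, k), (i, k, j), (j, i, k), (j, k, i), (k, i, j), (k, j, i)}"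
  proof cases
    case 1
    then show ?thesis using cancel[of j k] eq by auto
  next
    case 2
    then show ?thesis using cancel[of i k] eq swap by auto
  next
    case 3
    then show ?thesis using cancel[of i j] eq swap by auto
  qed
qed (auto simp: mono3_def ac_simps)

lemma lookup_cubic:
  "Poly_Mapping.lookup (cubic n t) m =
     (\<Sum>(i, j, k)\<in>{..<n} \<times> {..<n} \<times> {..<n}. t i j k when mono3 i j k = m)"
  by (simp add: cubic_def lookup_sum lookup_single sum.cartesian_product[symmetric])

text \<open>The factor in front of the coefficient is the product of the factorials of the exponents of
  the monomial, so that the number of distinct permutations of \<open>(i, j, k)\<close> is 6 divided by it.\<close>

lemma lookup_cubic_mono3:
  fixes t :: "nat \<Rightarrow> nat \<Rightarrow> nat \<Rightarrow> 'a::comm_ring_1"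
  assumes t: "symmetric3 n t" and ijk: "i < n" "j < n" "k < n"
  shows "(of_bool (i = j) + 1) * (of_bool (i = k) + of_bool (j = k) + 1) *
     Poly_Mapping.lookup (cubic n t) (mono3 i j k) = 6 * t i j k"
proof -
  define S where "S = {(i, j, k), (i, k, j), (j, i, k), (j, k, i), (k, i, j), (k, j, i)}"
  have S: "S \<subseteq> {..<n} \<times> {..<n} \<times> {..<n}"
    using ijk by (simp add: S_def)
  have sym: "t i k j = t i j k" "t j i k = t i j k" "t j k i = t i j k" "t k i j = t i j k"
    "t k j i = t i j k"
    using t ijk by (simp_all add: symmetric3_def)
  have "Poly_Mapping.lookup (cubic n t) (mono3 i j k) =
     (\<Sum>x\<in>{..<n} \<times> {..<n} \<times> {..<n}. if x \<in> S then case x of (a, b, c) \<Rightarrow> t a b c else 0)"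
    unfolding lookup_cubic
    by (rule sum.cong) (simp_all only: mono3_eq_iff S_def[symmetric] when_def split: prod.splits, simp)
  also have "\<dots> = (\<Sum>(a, b, c)\<in>S. t a b c)"
    using S by (simp add: sum.If_cases Int_absorb1 inf.absorb2)
  also have "\<dots> = (\<Sum>_\<in>S. t i j k)"
    by (rule sum.cong) (use sym in \<open>auto simp: S_def\<close>)
  also have "\<dots> = of_nat (card S) * t i j k"
    by simp
  finally show ?thesis
    \<comment> \<open>The coincidences among the indices determine \<open>card S\<close>: it is 6, 3
      or 1, while the factor is 1, 2 or 6.\<close>
    by (cases "i = j"; cases "i = k"; cases "j = k")
      (auto simp: S_def card_insert_if algebra_simps)
qed

section \<open>Partial derivatives, slices and coefficients\<close>

lemma lookup_partial_deriv:
  "Poly_Mapping.lookup (partial_deriv i p) m =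
     of_nat (Poly_Mapping.lookup m i + 1) * Poly_Mapping.lookup p (m + Poly_Mapping.single i 1)"
proof -
  let ?e = "Poly_Mapping.single i (1::nat)"
  have *: "(of_nat (Poly_Mapping.lookup m' i) * Poly_Mapping.lookup p m' when m' - ?e = m) =
     (if m' = m + ?e then of_nat (Poly_Mapping.lookup m i + 1) * Poly_Mapping.lookup p m' else 0)" for m'
  proof (cases "m' = m + ?e")
    case True
    then show ?thesis
      by (simp add: lookup_add)
  next
    case False
    \<comment> \<open>If \<open>m' - ?e = m\<close> although \<open>m'\<close> is not
      \<open>m + ?e\<close>, the subtraction was truncated at \<open>i\<close>; then the exponent is
      0 and annihilates the term.\<close>
    have "Poly_Mapping.lookup m' i = 0" if "m' - ?e = m"
    proof (rule ccontr)
      assume "Poly_Mapping.lookup m' i \<noteq> 0"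
      then have "m' = (m' - ?e) + ?e"
        by (intro poly_mapping_eqI) (auto simp: lookup_add lookup_minus lookup_single when_def)
      with that False show False
        by simp
    qed
    then show ?thesis
      using False by (auto simp: when_def)
  qed
  show ?thesis
    unfolding partial_deriv_def lookup_sum lookup_single *
    by (simp add: in_keys_iff)
qed

definition slice_tensor :: "nat \<Rightarrow> 'a::field_char_0 mpoly \<Rightarrow> nat \<Rightarrow> nat \<Rightarrow> nat \<Rightarrow> 'a" where
  "slice_tensor n f i j k = slice n f i $$ (j, k)"

lemma slice_carrier [simp]: "slice n f i \<in> carrier_mat n n"
  by (simp add: slice_def)

text \<open>Each derivative contributes one more than the exponent that remains after it: 1, then
  \<open>of_bool (i = j) + 1\<close>, then the second factor. This is the factor in
  \<open>lookup_cubic_mono3\<close>.\<close>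

lemma slice_tensor_eq:
  assumes "j < n" "k < n"
  shows "6 * slice_tensor n f i j k = (of_bool (i = j) + 1) *
     (of_bool (i = k) + of_bool (j = k) + 1) * Poly_Mapping.lookup f (mono3 i j k)"
  using assms
  by (auto simp: slice_tensor_def slice_def lookup_partial_deriv lookup_add lookup_single mono3_def
      when_def)

lemma symmetric3_slice_tensor: "symmetric3 n (slice_tensor n f)"
proof -
  have "6 * slice_tensor n f i j k = 6 * slice_tensor n f j i k"
    "6 * slice_tensor n f i j k = 6 * slice_tensor n f i k j"
    if "i < n" "j < n" "k < n" for i j k
    using that mono3_eq_iff[of i j k j i k] mono3_eq_iff[of i j k i k j]
    by (cases "i = j"; cases "i = k"; cases "j = k"; simp add: slice_tensor_eq)+
  then show ?thesis
    by (simp add: symmetric3_def)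
qed

text \<open>Three times, one variable is split off from the monomial, which lowers the degree by 1
  and adds no new variable; degree 0 leaves the monomial 1.\<close>

lemma mono3_exists:
  assumes "mono_degree m = 3" "Poly_Mapping.keys m \<subseteq> {..<n}"
  shows "\<exists>i<n. \<exists>j<n. \<exists>k<n. m = mono3 i j k"
proof -
  have step: "\<exists>i m'. i \<in> Poly_Mapping.keys m \<and> m = Poly_Mapping.single i 1 + m' \<and> mono_degree m' = d \<and>
     Poly_Mapping.keys m' \<subseteq> Poly_Mapping.keys m" if "mono_degree m = Suc d" for m d
  proof -
    have "Poly_Mapping.keys m \<noteq> {}"
      using that unfolding mono_degree_def by (metis Zero_not_Suc sum.empty)
    then obtain i where i: "i \<in> Poly_Mapping.keys m"
      by blast
    define m' where "m' = m - Poly_Mapping.single i 1"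
    have m: "m = Poly_Mapping.single i 1 + m'"
      using i unfolding m'_def
      by (intro poly_mapping_eqI) (auto simp: lookup_add lookup_minus lookup_single when_def in_keys_iff)
    have keys: "Poly_Mapping.keys m' \<subseteq> Poly_Mapping.keys m"
      unfolding m'_def by (auto simp: in_keys_iff lookup_minus)
    have "Poly_Mapping.lookup m x = (1 when x = i) + Poly_Mapping.lookup m' x" for x
      by (subst m) (simp add: lookup_add lookup_single eq_commute)
    then have "mono_degree m = (\<Sum>x\<in>Poly_Mapping.keys m. (1 when x = i) + Poly_Mapping.lookup m' x)"
      by (simp add: mono_degree_def)
    also have "\<dots> = 1 + (\<Sum>x\<in>Poly_Mapping.keys m. Poly_Mapping.lookup m' x)"
      using i by (simp add: sum.distrib when_def)
    also have "(\<Sum>x\<in>Poly_Mapping.keys m. Poly_Mapping.lookup m' x) = mono_degree m'"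
      unfolding mono_degree_def
      by (rule sum.mono_neutral_right) (use keys in \<open>auto simp: in_keys_iff\<close>)
    finally show ?thesis
      using that i m keys by (intro exI[of _ i] exI[of _ m']) auto
  qed
  obtain i m1 where 1: "i \<in> Poly_Mapping.keys m" "m = Poly_Mapping.single i 1 + m1" "mono_degree m1 = 2"
    "Poly_Mapping.keys m1 \<subseteq> Poly_Mapping.keys m"
    using step[of m 2] assms by auto
  obtain j m2 where 2: "j \<in> Poly_Mapping.keys m1" "m1 = Poly_Mapping.single j 1 + m2" "mono_degree m2 = 1"
    "Poly_Mapping.keys m2 \<subseteq> Poly_Mapping.keys m1"
    using step[of m1 1] 1 by auto
  obtain k m3 where 3: "k \<in> Poly_Mapping.keys m2" "m2 = Poly_Mapping.single k 1 + m3" "mono_degree m3 = 0"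
    using step[of m2 0] 2 by auto
  have "m3 = 0"
    using 3(3) by (intro poly_mapping_eqI) (auto simp: mono_degree_def in_keys_iff)
  then have "m = mono3 i j k"
    using 1 2 3 by (simp add: mono3_def ac_simps)
  then show ?thesis
    using 1 2 3 assms by (metis lessThan_iff subsetD)
qed

text \<open>At a monomial \<open>mono3 i j k\<close> both coefficients agree after multiplication by
  the same factor, which is nonzero in characteristic 0. All other monomials have coefficient 0 on
  both sides.\<close>

lemma cubic_slice_tensor:
  fixes f :: "'a::field_char_0 mpoly"
  assumes "f \<in> polys_in n" "homogeneous 3 f"
  shows "f = cubic n (slice_tensor n f)"
proof (rule poly_mapping_eqI)
  fix m
  show "Poly_Mapping.lookup f m = Poly_Mapping.lookup (cubic n (slice_tensor n f)) m"
  proof (cases "\<exists>i<n. \<exists>j<n. \<exists>k<n. m = mono3 i j k")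
    case True
    then obtain i j k where ijk: "i < n" "j < n" "k < n" and m: "m = mono3 i j k"
      by blast
    let ?x = "of_bool (i = j) + (1 :: 'a)" and ?y = "of_bool (i = k) + of_bool (j = k) + (1 :: 'a)"
    have "?x * ?y * Poly_Mapping.lookup (cubic n (slice_tensor n f)) m =
       ?x * ?y * Poly_Mapping.lookup f m"
      unfolding m lookup_cubic_mono3[OF symmetric3_slice_tensor ijk]
      by (rule slice_tensor_eq) (use ijk in auto)
    moreover have "?x * ?y \<noteq> 0"
      by (auto simp: of_bool_def)
    ultimately show ?thesis
      by auto
  next
    case False
    then have "m \<notin> Poly_Mapping.keys f"
      using mono3_exists[of m n] assms unfolding polys_in_def homogeneous_def by blast
    moreover have "Poly_Mapping.lookup (cubic n (slice_tensor n f)) m = 0"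
      unfolding lookup_cubic using False by (intro sum.neutral) (auto simp: when_def)
    ultimately show ?thesis
      by (simp add: in_keys_iff)
  qed
qed

lemma slice_tensor_cubic:
  fixes t :: "nat \<Rightarrow> nat \<Rightarrow> nat \<Rightarrow> 'a::field_char_0"
  assumes "symmetric3 n t" "i < n" "j < n" "k < n"
  shows "slice_tensor n (cubic n t) i j k = t i j k"
proof -
  have "6 * slice_tensor n (cubic n t) i j k = 6 * t i j k"
    using slice_tensor_eq[OF assms(3,4)] lookup_cubic_mono3[OF assms] by metis
  then show ?thesis
    by simp
qed

section \<open>Linear substitution as an action on tensors\<close>

lemma subst_poly_superset:
  assumes "finite S" "Poly_Mapping.keys p \<subseteq> S"
  shows "subst_poly \<sigma> p = (\<Sum>m\<in>S. pconst (Poly_Mapping.lookup p m) *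
     (\<Prod>i\<in>Poly_Mapping.keys m. \<sigma> i ^ Poly_Mapping.lookup m i))"
  unfolding subst_poly_def
  by (rule sum.mono_neutral_left) (use assms in \<open>auto simp: in_keys_iff pconst_def\<close>)

text \<open>The union of the key sets serves as a common index set; on it the coefficients add term
  by term, even where terms of \<open>p + q\<close> cancel.\<close>

lemma subst_poly_add: "subst_poly \<sigma> (p + q) = subst_poly \<sigma> p + subst_poly \<sigma> q"
proof -
  let ?S = "Poly_Mapping.keys p \<union> Poly_Mapping.keys q"
  have "finite ?S" "Poly_Mapping.keys (p + q) \<subseteq> ?S"
    by (auto dest: subsetD[OF keys_add])
  then show ?thesis
    by (simp add: subst_poly_superset[of ?S] lookup_add pconst_def single_add ring_distribs
        sum.distrib)
qed

lemma subst_poly_sum: "subst_poly \<sigma> (\<Sum>x\<in>S. p x) = (\<Sum>x\<in>S. subst_poly \<sigma> (p x))"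
proof (induction S rule: infinite_finite_induct)
  case empty
  then show ?case
    by (simp add: subst_poly_def)
qed (simp_all add: subst_poly_add, simp add: subst_poly_def)

lemma subst_poly_mono3:
  "subst_poly \<sigma> (Poly_Mapping.single (mono3 i j k) c) = pconst c * (\<sigma> i * \<sigma> j * \<sigma> k)"
proof -
  let ?m = "mono3 i j k"
  have "(\<Prod>x\<in>Poly_Mapping.keys ?m. \<sigma> x ^ Poly_Mapping.lookup ?m x) =
     (\<Prod>x\<in>{i, j, k}. \<sigma> x ^ Poly_Mapping.lookup ?m x)"
    by (rule prod.mono_neutral_left) (auto simp: in_keys_iff lookup_mono3)
  moreover
  \<comment> \<open>The exponent is a sum of three indicators, so the product splits into three
    products with one nontrivial factor each, whatever coincidences there are among
    \<open>i\<close>, \<open>j\<close>, \<open>k\<close>.\<close>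
  have "\<sigma> x ^ of_bool (y = x) = (if y = x then \<sigma> x else 1)" for x y
    by simp
  then have "(\<Prod>x\<in>{i, j, k}. \<sigma> x ^ Poly_Mapping.lookup ?m x) = \<sigma> i * \<sigma> j * \<sigma> k"
    unfolding lookup_mono3 power_add prod.distrib
    by (simp only: prod.delta' finite.intros) simp
  ultimately show ?thesis
    by (simp add: subst_poly_superset[of "{?m}"])
qed

text \<open>The contraction of \<open>t\<close> with \<open>A\<close> in all three slots, which is
  the tensor of the form \<open>p(Ax)\<close>. The sums are nested so that one slot can be treated
  at a time.\<close>

definition transform3 ::
  "nat \<Rightarrow> 'a::comm_ring_1 mat \<Rightarrow> (nat \<Rightarrow> nat \<Rightarrow> nat \<Rightarrow> 'a) \<Rightarrow> nat \<Rightarrow> nat \<Rightarrow> nat \<Rightarrow> 'a" where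
  "transform3 n A t i j k =
     (\<Sum>a<n. A $$ (a, i) * (\<Sum>b<n. A $$ (b, j) * (\<Sum>c<n. A $$ (c, k) * t a b c)))"

text \<open>The sum of the tensor cubes of the rows of \<open>A\<close>.\<close>

definition cube_sum :: "nat \<Rightarrow> 'a::comm_ring_1 mat \<Rightarrow> nat \<Rightarrow> nat \<Rightarrow> nat \<Rightarrow> 'a" where
  "cube_sum n A i j k = (\<Sum>l<n. A $$ (l, i) * A $$ (l, j) * A $$ (l, k))"

lemma symmetric3_cube_sum: "symmetric3 n (cube_sum n A)"
  by (simp add: symmetric3_def cube_sum_def mult_ac)

lemma cubic_cong:
  assumes "\<And>i j k. i < n \<Longrightarrow> j < n \<Longrightarrow> k < n \<Longrightarrow> t i j k = t' i j k"
  shows "cubic n t = cubic n t'"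
  unfolding cubic_def by (intro sum.cong refl) (use assms in auto)

lemma symmetric3_transform3:
  assumes "symmetric3 n t"
  shows "symmetric3 n (transform3 n A t)"
proof -
  have t: "t a b c = t b a c" "t a b c = t a c b" if "a < n" "b < n" "c < n" for a b c
    using assms that by (auto simp: symmetric3_def)
  have 1: "transform3 n A t i j k = transform3 n A t j i k" for i j k
  proof -
    have "transform3 n A t i j k =
        (\<Sum>a<n. \<Sum>b<n. A $$ (b, j) * (A $$ (a, i) * (\<Sum>c<n. A $$ (c, k) * t b a c)))"
      unfolding transform3_def sum_distrib_left by (intro sum.cong refl) (simp add: t(1) mult_ac)
    also have "\<dots> = transform3 n A t j i k"
      unfolding transform3_def sum_distrib_left[symmetric] by (subst sum.swap) (simp add: sum_distrib_left)
    finally show ?thesis .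
  qed
  have 2: "transform3 n A t i j k = transform3 n A t i k j" for i j k
  proof -
    have "(\<Sum>b<n. A $$ (b, j) * (\<Sum>c<n. A $$ (c, k) * t a b c)) =
        (\<Sum>b<n. A $$ (b, k) * (\<Sum>c<n. A $$ (c, j) * t a b c))" if "a < n" for a
      unfolding sum_distrib_left
      by (subst sum.swap) (intro sum.cong refl, simp add: t(2)[OF that] mult_ac)
    then show ?thesis
      unfolding transform3_def by (intro sum.cong refl) simp
  qed
  show ?thesis
    unfolding symmetric3_def using 1 2 by blast
qed

lemma single_sum: "Poly_Mapping.single m (\<Sum>x\<in>S. f x) = (\<Sum>x\<in>S. Poly_Mapping.single m (f x))"
  by (induction S rule: infinite_finite_induct) (simp_all add: single_add)

lemma single_mono3:
  "pconst (d :: 'a::comm_ring_1) *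
     ((pconst a * pvar i) * (pconst b * pvar j) * (pconst c * pvar k)) =
   Poly_Mapping.single (mono3 i j k) (a * (b * (c * d)))"
  by (simp add: pconst_def pvar_def mult_single mono3_def mult_ac add_ac)

text \<open>Expand the product of the three linear forms for each entry of \<open>t\<close>, then
  exchange the sum over entries with the sum over monomials.\<close>

lemma lin_subst_cubic:
  fixes t :: "nat \<Rightarrow> nat \<Rightarrow> nat \<Rightarrow> 'a::comm_ring_1"
  assumes "dim_col A = n"
  shows "lin_subst A (cubic n t) = cubic n (transform3 n A t)"
proof -
  let ?N = "{..<n} \<times> {..<n} \<times> {..<n}"
  have c: "cubic n u = (\<Sum>(i, j, k)\<in>?N. Poly_Mapping.single (mono3 i j k) (u i j k))"
    for u :: "nat \<Rightarrow> nat \<Rightarrow> nat \<Rightarrow> 'a"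
    by (simp add: cubic_def sum.cartesian_product)
  have prod3: "pconst d * ((\<Sum>i<n. pconst (u i) * pvar i) * (\<Sum>j<n. pconst (v j) * pvar j) *
        (\<Sum>k<n. pconst (w k) * pvar k)) =
      (\<Sum>i<n. \<Sum>j<n. \<Sum>k<n. Poly_Mapping.single (mono3 i j k) (u i * (v j * (w k * d))))"
    for u v w and d :: 'a
    unfolding single_mono3[symmetric]
    by (simp only: sum_distrib_right mult.assoc) (simp only: sum_distrib_left)
  have "lin_subst A (cubic n t) = (\<Sum>(a, b, c)\<in>?N. \<Sum>(i, j, k)\<in>?N.
      Poly_Mapping.single (mono3 i j k) (A $$ (a, i) * (A $$ (b, j) * (A $$ (c, k) * t a b c))))"
    unfolding lin_subst_def assms c subst_poly_sum
    by (rule sum.cong, simp)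
      (simp add: subst_poly_mono3 prod3 sum.cartesian_product[symmetric] split: prod.splits)
  also have "\<dots> = (\<Sum>(i, j, k)\<in>?N. \<Sum>(a, b, c)\<in>?N.
      Poly_Mapping.single (mono3 i j k) (A $$ (a, i) * (A $$ (b, j) * (A $$ (c, k) * t a b c))))"
    unfolding split_def by (rule sum.swap)
  also have "\<dots> = cubic n (transform3 n A t)"
    unfolding c transform3_def
    by (rule sum.cong, simp)
      (simp add: single_sum[symmetric] sum_distrib_left sum.cartesian_product split_def)
  finally show ?thesis .
qed

lemma sum_of_cubes_eq_cubic:
  "sum_of_cubes n = cubic n (\<lambda>i j k. of_bool (i = j \<and> i = k) :: 'a::comm_ring_1)"
proof -
  have inner: "(\<Sum>k<n. Poly_Mapping.single (mono3 i j k) (of_bool (i = j \<and> i = k) :: 'a)) =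
      (if i = j then Poly_Mapping.single (mono3 i i i) 1 else 0)" if "i < n" for i j
  proof (cases "i = j")
    case True
    have "(\<Sum>k<n. Poly_Mapping.single (mono3 i j k) (of_bool (i = j \<and> i = k) :: 'a)) =
        (\<Sum>k<n. if i = k then Poly_Mapping.single (mono3 i i i) 1 else 0)"
      using True by (intro sum.cong refl) auto
    also have "\<dots> = Poly_Mapping.single (mono3 i i i) 1"
      using that by (simp only: sum.delta' finite_lessThan lessThan_iff if_True)
    finally show ?thesis
      using True by simp
  qed simp
  have "(\<Sum>j<n. \<Sum>k<n. Poly_Mapping.single (mono3 i j k) (of_bool (i = j \<and> i = k) :: 'a)) = pvar i ^ 3"
    if "i < n" for i
  proof -
    have "(\<Sum>j<n. \<Sum>k<n. Poly_Mapping.single (mono3 i j k) (of_bool (i = j \<and> i = k) :: 'a)) =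
        Poly_Mapping.single (mono3 i i i) 1"
      using that by (simp only: inner sum.delta' finite_lessThan lessThan_iff if_True)
    also have "\<dots> = pvar i ^ 3"
      by (simp add: pvar_def mono3_def numeral_3_eq_3 mult_single add.assoc)
    finally show ?thesis .
  qed
  then show ?thesis
    unfolding sum_of_cubes_def cubic_def by (intro sum.cong) auto
qed

lemma lin_subst_sum_of_cubes:
  assumes "dim_col A = n"
  shows "lin_subst A (sum_of_cubes n) = cubic n (cube_sum n A)"
proof -
  have "(\<Sum>a<n. A $$ (a, i) * (\<Sum>b<n. A $$ (b, j) * (\<Sum>c<n. A $$ (c, k) * of_bool (a = b \<and> a = c)))) =
     cube_sum n A i j k" for i j k
  proof -
    have "(\<Sum>c<n. A $$ (c, k) * of_bool (a = b \<and> a = c)) = of_bool (a = b) * A $$ (a, k)" if "a < n" for a b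
      using that by (cases "a = b") (simp_all add: of_bool_def if_distrib cong: if_cong)
    moreover have "(\<Sum>b<n. A $$ (b, j) * (of_bool (a = b) * A $$ (a, k))) = A $$ (a, j) * A $$ (a, k)"
      if "a < n" for a
    proof -
      have "(\<Sum>b<n. A $$ (b, j) * (of_bool (a = b) * A $$ (a, k))) =
          (\<Sum>b<n. if a = b then A $$ (a, j) * A $$ (a, k) else 0)"
        by (rule sum.cong) auto
      then show ?thesis
        using that by simp
    qed
    ultimately show ?thesis
      unfolding cube_sum_def by (intro sum.cong refl) (simp add: mult.assoc)
  qed
  then show ?thesis
    unfolding sum_of_cubes_eq_cubic lin_subst_cubic[OF assms]
    by (intro cubic_cong) (simp only: transform3_def)
qed

text \<open>A cubic form and its symmetric tensor determine each other, so the equation of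
  polynomials turns into an equation of tensors.\<close>

lemma equiv_sum_of_cubes_iff:
  fixes f :: "'a::field_char_0 mpoly"
  assumes "f \<in> polys_in n" "homogeneous 3 f"
  shows "equiv_sum_of_cubes n f \<longleftrightarrow> (\<exists>A\<in>carrier_mat n n. invertible_mat A \<and>
     (\<forall>i<n. \<forall>j<n. \<forall>k<n. slice_tensor n f i j k = cube_sum n A i j k))"
proof -
  have "f = lin_subst A (sum_of_cubes n) \<longleftrightarrow>
     (\<forall>i<n. \<forall>j<n. \<forall>k<n. slice_tensor n f i j k = cube_sum n A i j k)"
    if "A \<in> carrier_mat n n" for A
  proof -
    have "lin_subst A (sum_of_cubes n) = cubic n (cube_sum n A)"
      using that by (intro lin_subst_sum_of_cubes) auto
    then show ?thesis
      using slice_tensor_cubic[OF symmetric3_cube_sum, of _ n _ _ A] cubic_slice_tensor[OF assms]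
        cubic_cong[of n "slice_tensor n f" "cube_sum n A"] by metis
  qed
  then show ?thesis
    unfolding equiv_sum_of_cubes_def by blast
qed

lemma slice_tensor_lin_subst:
  fixes f :: "'a::field_char_0 mpoly"
  assumes "f \<in> polys_in n" "homogeneous 3 f" "R \<in> carrier_mat n n" "i < n" "j < n" "k < n"
  shows "slice_tensor n (lin_subst R f) i j k = transform3 n R (slice_tensor n f) i j k"
proof -
  have "lin_subst R f = cubic n (transform3 n R (slice_tensor n f))"
    by (subst cubic_slice_tensor[OF assms(1,2)], rule lin_subst_cubic) (use assms in auto)
  then show ?thesis
    using slice_tensor_cubic[OF symmetric3_transform3[OF symmetric3_slice_tensor]] assms by metis
qed

subsection \<open>Simultaneous diagonalization\<close>

lemma index_mult_mat_sum:
  assumes "A \<in> carrier_mat n n" "B \<in> carrier_mat n n" "i < n" "j < n"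
  shows "(A * B) $$ (i, j) = (\<Sum>k<n. A $$ (i, k) * B $$ (k, j))"
  using assms by (auto simp: scalar_prod_def lessThan_atLeast0)

lemma index_mult_mat_vec_sum:
  assumes "A \<in> carrier_mat n n" "v \<in> carrier_vec n" "i < n"
  shows "(A *\<^sub>v v) $ i = (\<Sum>k<n. A $$ (i, k) * v $ k)"
  using assms by (auto simp: scalar_prod_def lessThan_atLeast0)

lemma invertible_matI:
  fixes A :: "'a::field mat"
  assumes "A \<in> carrier_mat n n" "B \<in> carrier_mat n n" "A * B = 1\<^sub>m n"
  shows "invertible_mat A"
  using assms mat_mult_left_right_inverse[OF assms]
  by (auto simp: invertible_mat_def inverts_mat_def)

lemma invertible_matE:
  fixes A :: "'a::field mat"
  assumes "invertible_mat A" "A \<in> carrier_mat n n"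
  obtains B where "B \<in> carrier_mat n n" "A * B = 1\<^sub>m n" "B * A = 1\<^sub>m n"
proof -
  obtain B where B: "A * B = 1\<^sub>m n" "B * A = 1\<^sub>m (dim_row B)"
    using assms by (auto simp: invertible_mat_def inverts_mat_def)
  then have "B \<in> carrier_mat n n"
    using assms(2) by (metis carrier_matI carrier_matD index_mult_mat(2,3) index_one_mat(2,3))
  with B that show thesis
    by (metis carrier_matD(1))
qed

lemma invertible_mat_iff_det:
  fixes A :: "'a::field mat"
  assumes A: "A \<in> carrier_mat n n"
  shows "invertible_mat A \<longleftrightarrow> det A \<noteq> 0"
proof
  assume "invertible_mat A"
  then obtain B where B: "B \<in> carrier_mat n n" "A * B = 1\<^sub>m n"
    using A by (elim invertible_matE)
  then have "det A * det B = 1"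
    using det_mult[OF A B(1)] by simp
  then show "det A \<noteq> 0"
    by auto
next
  assume "det A \<noteq> 0"
  then show "invertible_mat A"
    using det_non_zero_imp_unit[OF A, of undefined] A
    by (auto simp: Units_def ring_mat_def intro: invertible_matI)
qed

text \<open>The dual form of the statement that \<open>v\<close> is a sum of eigenvectors of \<open>A\<close>, the eigenvectors
  being the projections of \<open>v\<close> to the eigenspaces; these inherit every eigenvalue equation of \<open>v\<close>
  for a matrix that commutes with \<open>A\<close>.\<close>

lemma eigenvector_separating:
  fixes A :: "'a::field mat"
  assumes "diagonalizable_mat A" and A: "A \<in> carrier_mat n n"
    and v: "v \<in> carrier_vec n" and w: "w \<in> carrier_vec n" and wv: "w \<bullet> v \<noteq> 0"
  obtains u c where "u \<in> carrier_vec n" "w \<bullet> u \<noteq> 0" "A *\<^sub>v u = c \<cdot>\<^sub>v u"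
    "\<And>B d. B \<in> carrier_mat n n \<Longrightarrow> A * B = B * A \<Longrightarrow> B *\<^sub>v v = d \<cdot>\<^sub>v v \<Longrightarrow> B *\<^sub>v u = d \<cdot>\<^sub>v u"
proof -
  obtain D P Q where D: "diagonal_mat D" and PQ: "P * Q = 1\<^sub>m n" "Q * P = 1\<^sub>m n" and APDQ: "A = P * D * Q"
    and [simp]: "D \<in> carrier_mat n n" "P \<in> carrier_mat n n" "Q \<in> carrier_mat n n"
    using assms(1) A unfolding diagonalizable_mat_def similar_mat_def similar_mat_wit_def Let_def
    by auto
  note [simp] = A v w
  have [simp]: "X *\<^sub>v x \<in> carrier_vec n" if "X \<in> carrier_mat n n" "x \<in> carrier_vec n" for X x
    using that by (rule mult_mat_vec_carrier)
  have [simp]: "X * Y \<in> carrier_mat n n" if "X \<in> carrier_mat n n" "Y \<in> carrier_mat n n" for X Y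
    using that by (rule mult_carrier_mat)
  have mult_vec: "X * Y *\<^sub>v x = X *\<^sub>v (Y *\<^sub>v x)"
    if "X \<in> carrier_mat n n" "Y \<in> carrier_mat n n" "x \<in> carrier_vec n" for X Y :: "'a mat" and x
    using that by (rule assoc_mult_mat_vec)
  have D0: "D $$ (i, j) = 0" if "i < n" "j < n" "i \<noteq> j" for i j
    using D that carrier_matD[of D n n] by (auto simp: diagonal_mat_def)
  \<comment> \<open>The columns of \<open>P\<close> are an eigenbasis of \<open>A\<close>. Here
    \<open>z\<close> holds the coordinates of \<open>v\<close> and \<open>a\<close> those of the
    functional \<open>w\<close>; \<open>y c\<close> keeps the coordinates of eigenvalue
    \<open>c\<close>, so \<open>P *\<^sub>v y c\<close> is the projection of \<open>v\<close> to
    that eigenspace.\<close>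
  define z where "z = Q *\<^sub>v v"
  define a where "a = P\<^sup>T *\<^sub>v w"
  define y where "y c = vec n (\<lambda>i. if D $$ (i, i) = c then z $ i else 0)" for c
  have [simp]: "z \<in> carrier_vec n" "a \<in> carrier_vec n" "y c \<in> carrier_vec n" for c
    by (auto simp: z_def a_def y_def intro!: mult_mat_vec_carrier[of _ n n])
  have Pz: "P *\<^sub>v z = v"
    using PQ by (simp add: z_def mult_vec[symmetric])
  have wP: "w \<bullet> (P *\<^sub>v x) = (\<Sum>i<n. a $ i * x $ i)" if "x \<in> carrier_vec n" for x
    using transpose_vec_mult_scalar[of P n n x w] that
    by (simp add: a_def[symmetric] scalar_prod_def lessThan_atLeast0)
  let ?C = "(\<lambda>i. D $$ (i, i)) ` {..<n}"
  have "w \<bullet> (P *\<^sub>v y c) = (\<Sum>i | i \<in> {..<n} \<and> D $$ (i, i) = c. a $ i * z $ i)" for c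
  proof -
    have "w \<bullet> (P *\<^sub>v y c) = (\<Sum>i<n. if D $$ (i, i) = c then a $ i * z $ i else 0)"
      unfolding wP[of "y c", simplified] by (rule sum.cong) (auto simp: y_def)
    then show ?thesis
      by (simp only: sum.inter_filter[OF finite_lessThan])
  qed
  \<comment> \<open>Grouping the coordinates by eigenvalue shows that the values of \<open>w\<close>
    at the projections add up to \<open>w \<bullet> v\<close>, so one of them is nonzero.\<close>
  then have "(\<Sum>c\<in>?C. w \<bullet> (P *\<^sub>v y c)) = (\<Sum>c\<in>?C. \<Sum>i | i \<in> {..<n} \<and> D $$ (i, i) = c. a $ i * z $ i)"
    by (simp only:)
  also have "\<dots> = (\<Sum>i<n. a $ i * z $ i)"
    by (rule sum.group) auto
  also have "\<dots> = w \<bullet> v"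
    using wP[of z] Pz by simp
  finally obtain c where c: "w \<bullet> (P *\<^sub>v y c) \<noteq> 0"
    using wv sum.not_neutral_contains_not_neutral by (metis (no_types, lifting))
  show thesis
  proof (rule that[of "P *\<^sub>v y c" c])
    show "P *\<^sub>v y c \<in> carrier_vec n"
      by simp
    show "w \<bullet> (P *\<^sub>v y c) \<noteq> 0"
      by (rule c)
    have Dy: "D *\<^sub>v y c = c \<cdot>\<^sub>v y c"
    proof (rule eq_vecI)
      fix i assume "i < dim_vec (c \<cdot>\<^sub>v y c)"
      then have i: "i < n"
        by (simp add: y_def)
      have "(D *\<^sub>v y c) $ i = (\<Sum>k<n. if k = i then D $$ (i, i) * y c $ i else 0)"
        unfolding index_mult_mat_vec_sum[of D n "y c", simplified, OF i]
        by (rule sum.cong) (use i D0 in auto)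
      then show "(D *\<^sub>v y c) $ i = (c \<cdot>\<^sub>v y c) $ i"
        using i by (simp add: y_def)
    qed (simp add: y_def carrier_matD[of D n n])
    have "A *\<^sub>v (P *\<^sub>v y c) = P *\<^sub>v (D *\<^sub>v ((Q * P) *\<^sub>v y c))"
      unfolding APDQ by (simp add: mult_vec)
    then show "A *\<^sub>v (P *\<^sub>v y c) = c \<cdot>\<^sub>v (P *\<^sub>v y c)"
      by (simp add: PQ Dy mult_mat_vec[of P n n])
  next
    fix B d
    assume B[simp]: "B \<in> carrier_mat n n" and comm: "A * B = B * A" and Bv: "B *\<^sub>v v = d \<cdot>\<^sub>v v"
    \<comment> \<open>\<open>B\<close> written in the eigenbasis of \<open>A\<close>. It commutes
      with \<open>D\<close>, so its entries between distinct eigenvalues vanish.\<close>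
    define C where "C = Q * B * P"
    have [simp]: "C \<in> carrier_mat n n"
      by (auto simp: C_def)
    have mult_assoc: "(X * Y) * Z = X * (Y * Z)"
      if "X \<in> carrier_mat n n" "Y \<in> carrier_mat n n" "Z \<in> carrier_mat n n" for X Y Z :: "'a mat"
      using that by simp
    have cancel: "Q * (P * X) = X" if "X \<in> carrier_mat n n" for X
      using that PQ assoc_mult_mat[of Q n n P n X n] by simp
    have "D * C = Q * (A * B) * P" "C * D = Q * (B * A) * P"
      by (simp_all add: C_def APDQ mult_assoc cancel PQ right_mult_one_mat[of _ n n])
    then have CD: "D * C = C * D"
      using comm by simp
    have C0: "C $$ (i, j) = 0" if "i < n" "j < n" "D $$ (i, i) \<noteq> D $$ (j, j)" for i j
    proof -
      have "(D * C) $$ (i, j) = (\<Sum>k<n. if k = i then D $$ (i, i) * C $$ (i, j) else 0)"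
        unfolding index_mult_mat_sum[of D n C, simplified, OF that(1,2)]
        by (rule sum.cong) (use that D0 in auto)
      moreover have "(C * D) $$ (i, j) = (\<Sum>k<n. if k = j then D $$ (j, j) * C $$ (i, j) else 0)"
        unfolding index_mult_mat_sum[of C n D, simplified, OF that(1,2)]
        by (rule sum.cong) (use that D0 in auto)
      ultimately show ?thesis
        using that CD by simp
    qed
    have "C *\<^sub>v z = (Q * B * (P * Q)) *\<^sub>v v"
      by (simp add: C_def z_def mult_vec[symmetric] mult_assoc)
    then have Cz: "C *\<^sub>v z = d \<cdot>\<^sub>v z"
      using Bv by (simp add: PQ z_def mult_vec right_mult_one_mat[of _ n n] mult_mat_vec[of Q n n])
    \<comment> \<open>As \<open>C\<close> is block diagonal with respect to the eigenvalues of
      \<open>A\<close>, restricting \<open>z\<close> to one block preserves the eigenvalue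
      equation.\<close>
    have Cy: "C *\<^sub>v y c = d \<cdot>\<^sub>v y c"
    proof (rule eq_vecI)
      fix i assume "i < dim_vec (d \<cdot>\<^sub>v y c)"
      then have i: "i < n"
        by (simp add: y_def)
      have "(C *\<^sub>v y c) $ i = (\<Sum>k<n. if D $$ (i, i) = c then C $$ (i, k) * z $ k else 0)"
        unfolding index_mult_mat_vec_sum[of C n "y c", simplified, OF i]
        by (rule sum.cong) (use i C0 in \<open>auto simp: y_def\<close>)
      also have "\<dots> = (if D $$ (i, i) = c then (C *\<^sub>v z) $ i else 0)"
        using index_mult_mat_vec_sum[of C n z, simplified, OF i] by simp
      finally show "(C *\<^sub>v y c) $ i = (d \<cdot>\<^sub>v y c) $ i"
        using i unfolding Cz by (simp add: y_def carrier_vecD[of z n])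
    qed (simp add: y_def carrier_matD[of C n n])
    have "B *\<^sub>v (P *\<^sub>v y c) = (P * Q * B * P) *\<^sub>v y c"
      using PQ by (simp add: mult_vec[symmetric] left_mult_one_mat[of _ n n])
    also have "\<dots> = P *\<^sub>v (C *\<^sub>v y c)"
      by (simp add: C_def mult_assoc mult_vec[symmetric])
    also have "\<dots> = d \<cdot>\<^sub>v (P *\<^sub>v y c)"
      by (simp add: Cy mult_mat_vec[of P n n])
    finally show "B *\<^sub>v (P *\<^sub>v y c) = d \<cdot>\<^sub>v (P *\<^sub>v y c)" .
  qed
qed

text \<open>Induction over the matrices: projecting to an eigenspace of the next one keeps the
  eigenvalue equations for those already treated, because they commute with it.\<close>

lemma joint_eigenvector_separating:
  fixes A :: "'i \<Rightarrow> 'a::field mat"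
  assumes "finite K" "\<And>k. k \<in> K \<Longrightarrow> A k \<in> carrier_mat n n" "\<And>k. k \<in> K \<Longrightarrow> diagonalizable_mat (A k)"
    and "\<And>k l. k \<in> K \<Longrightarrow> l \<in> K \<Longrightarrow> A k * A l = A l * A k"
    and "v \<in> carrier_vec n" "w \<in> carrier_vec n" "w \<bullet> v \<noteq> 0"
  shows "\<exists>u\<in>carrier_vec n. w \<bullet> u \<noteq> 0 \<and> (\<forall>k\<in>K. \<exists>c. A k *\<^sub>v u = c \<cdot>\<^sub>v u)"
  using assms(1-4)
proof (induction K rule: finite_induct)
  case empty
  then show ?case
    using assms(5-7) by auto
next
  case (insert k K)
  then obtain u where u: "u \<in> carrier_vec n" "w \<bullet> u \<noteq> 0" "\<forall>k\<in>K. \<exists>c. A k *\<^sub>v u = c \<cdot>\<^sub>v u"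
    by auto
  obtain u' c where u': "u' \<in> carrier_vec n" "w \<bullet> u' \<noteq> 0" "A k *\<^sub>v u' = c \<cdot>\<^sub>v u'"
    "\<And>B d. B \<in> carrier_mat n n \<Longrightarrow> A k * B = B * A k \<Longrightarrow> B *\<^sub>v u = d \<cdot>\<^sub>v u \<Longrightarrow> B *\<^sub>v u' = d \<cdot>\<^sub>v u'"
    using eigenvector_separating[of "A k" n u w] insert.prems u(1,2) assms(6) by (metis insertI1)
  have "\<exists>c. A l *\<^sub>v u' = c \<cdot>\<^sub>v u'" if "l \<in> insert k K" for l
    using that u(3) u'(3) u'(4)[of "A l"] insert.prems by blast
  with u' show ?case
    by blast
qed

text \<open>An exchange argument: starting from the identity matrix, the columns are replaced one at
  a time by joint eigenvectors while the matrix stays invertible.\<close>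

lemma joint_eigenvector_basis:
  fixes A :: "'i \<Rightarrow> 'a::field mat"
  assumes "finite K" "\<And>k. k \<in> K \<Longrightarrow> A k \<in> carrier_mat n n" "\<And>k. k \<in> K \<Longrightarrow> diagonalizable_mat (A k)"
    and "\<And>k l. k \<in> K \<Longrightarrow> l \<in> K \<Longrightarrow> A k * A l = A l * A k"
  shows "\<exists>Q\<in>carrier_mat n n. invertible_mat Q \<and> (\<forall>j<n. \<forall>k\<in>K. \<exists>c. A k *\<^sub>v col Q j = c \<cdot>\<^sub>v col Q j)"
proof -
  have "\<exists>Q\<in>carrier_mat n n. invertible_mat Q \<and> (\<forall>j<m. \<forall>k\<in>K. \<exists>c. A k *\<^sub>v col Q j = c \<cdot>\<^sub>v col Q j)"
    if "m \<le> n" for m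
    using that
  proof (induction m)
    case 0
    show ?case
      by (intro bexI[of _ "1\<^sub>m n"] conjI invertible_matI[of _ n "1\<^sub>m n"]) auto
  next
    case (Suc m)
    then obtain Q where Q: "Q \<in> carrier_mat n n" "invertible_mat Q"
      "\<forall>j<m. \<forall>k\<in>K. \<exists>c. A k *\<^sub>v col Q j = c \<cdot>\<^sub>v col Q j"
      by auto
    obtain Q' where Q': "Q' \<in> carrier_mat n n" "Q * Q' = 1\<^sub>m n" "Q' * Q = 1\<^sub>m n"
      using Q by (elim invertible_matE)
    have m: "m < n"
      using Suc by simp
    \<comment> \<open>Row \<open>m\<close> of the inverse reads off the coordinate along column
      \<open>m\<close>; it is 1 on that column, and is the functional that the new eigenvector must
      not annihilate.\<close>
    have "row Q' m \<bullet> col Q m = (Q' * Q) $$ (m, m)"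
      using Q(1) Q'(1) m by simp
    moreover have "col Q m \<in> carrier_vec n" "row Q' m \<in> carrier_vec n"
      using Q(1) Q'(1) m by auto
    ultimately obtain u where u: "u \<in> carrier_vec n" "row Q' m \<bullet> u \<noteq> 0" "\<forall>k\<in>K. \<exists>c. A k *\<^sub>v u = c \<cdot>\<^sub>v u"
      using joint_eigenvector_separating[of K A n "col Q m" "row Q' m"] assms Q'(3) m by auto
    define x where "x = Q' *\<^sub>v u"
    have x: "x \<in> carrier_vec n" "Q *\<^sub>v x = u" "x $ m \<noteq> 0"
      using Q(1) Q' u m by (auto simp: x_def assoc_mult_mat_vec[symmetric, of _ n n _ n])
    define R where "R = replace_col Q u m"
    have R: "R \<in> carrier_mat n n"
      using Q(1) by (simp add: R_def replace_col_def)
    \<comment> \<open>Cramer's rule: \<open>det R\<close> is \<open>x $ m * det Q\<close>, with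
      \<open>x\<close> the coordinates of \<open>u\<close> in the columns of
      \<open>Q\<close>.\<close>
    have "det R \<noteq> 0"
      using cramer_lemma_mat[OF Q(1) x(1) m] x(2,3) Q invertible_mat_iff_det[OF Q(1)]
      by (simp add: R_def)
    moreover have "col R j = (if j = m then u else col Q j)" if "j < n" for j
      using that Q(1) u(1) by (auto simp: R_def replace_col_def)
    ultimately show ?case
      using R u(3) Q(3) m invertible_mat_iff_det[OF R] by (intro bexI[of _ R]) (auto simp: less_Suc_eq)
  qed
  then show ?thesis
    by blast
qed

subsection \<open>Tensors with commuting diagonalizable slices\<close>

text \<open>\<open>Q\<close> is a basis of joint eigenvectors of the matrices \<open>T\<^sub>0\<inverse> T\<^sub>i\<close>, with eigenvalues \<open>ev i b\<close>, and
  \<open>W = T\<^sub>0 Q\<close>; indices start at 0.\<close>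

lemma tensor_decomposition:
  fixes t :: "nat \<Rightarrow> nat \<Rightarrow> nat \<Rightarrow> 'a::field" and Q Q' W W' ev :: "nat \<Rightarrow> nat \<Rightarrow> 'a"
  assumes t: "symmetric3 n t" and n: "0 < n"
    and QQ': "\<And>i j. i < n \<Longrightarrow> j < n \<Longrightarrow> (\<Sum>b<n. Q i b * Q' b j) = of_bool (i = j)"
    and W'W: "\<And>a b. a < n \<Longrightarrow> b < n \<Longrightarrow> (\<Sum>i<n. W' a i * W i b) = of_bool (a = b)"
    and W: "\<And>i b. i < n \<Longrightarrow> b < n \<Longrightarrow> W i b = (\<Sum>k<n. t 0 i k * Q k b)"
    and ev: "\<And>i j b. i < n \<Longrightarrow> j < n \<Longrightarrow> b < n \<Longrightarrow> (\<Sum>k<n. t i j k * Q k b) = ev i b * W j b"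
  obtains d where "\<And>b. b < n \<Longrightarrow> d b \<noteq> 0"
    "\<And>i j k. i < n \<Longrightarrow> j < n \<Longrightarrow> k < n \<Longrightarrow> t i j k = (\<Sum>b<n. d b * (W i b * W j b * W k b))"
proof -
  have sym: "t i j k = t j i k" "t i j k = t i k j" if "i < n" "j < n" "k < n" for i j k
    using t that by (auto simp: symmetric3_def)
  \<comment> \<open>The eigenvalue equation at \<open>j = 0\<close>, where symmetry turns slice
    \<open>i\<close> back into slice 0.\<close>
  have W_ev: "W i b = ev i b * W 0 b" if "i < n" "b < n" for i b
  proof -
    have "W i b = (\<Sum>k<n. t i 0 k * Q k b)"
      unfolding W[OF that] by (rule sum.cong) (use sym(1) n that in auto)
    then show ?thesis
      using ev that n by simp
  qed
  have W_nz: "\<exists>i<n. W i b \<noteq> 0" if "b < n" for b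
  proof (rule ccontr)
    assume "\<not> ?thesis"
    then have "(\<Sum>i<n. W' b i * W i b) = 0"
      by simp
    then show False
      using W'W[of b b] that by simp
  qed
  \<comment> \<open>Otherwise \<open>W_ev\<close> would make the whole column \<open>b\<close>
    vanish, against the left inverse \<open>W'\<close>.\<close>
  have W0: "W 0 b \<noteq> 0" if "b < n" for b
    using W_nz[OF that] W_ev that by (metis mult_zero_right)
  \<comment> \<open>The bilinear form of slice \<open>i\<close> at the columns \<open>a\<close> and
    \<open>b\<close> of \<open>Q\<close>; \<open>g\<close> below is the one of slice 0.\<close>
  define G where "G i a b = (\<Sum>j<n. Q j a * (\<Sum>k<n. t i j k * Q k b))" for i a b
  have G_sym: "G i a b = G i b a" if "i < n" for i a b
  proof -
    have "G i a b = (\<Sum>j<n. \<Sum>k<n. Q k b * (t i k j * Q j a))"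
      unfolding G_def sum_distrib_left
      by (intro sum.cong refl) (use sym(2) that in \<open>simp add: mult_ac\<close>)
    also have "\<dots> = G i b a"
      unfolding G_def sum_distrib_left by (rule sum.swap)
    finally show ?thesis .
  qed
  define g where "g a b = (\<Sum>j<n. Q j a * W j b)" for a b
  have G_g: "G i a b = ev i b * g a b" if "i < n" "b < n" for i a b
  proof -
    have "G i a b = (\<Sum>j<n. Q j a * (ev i b * W j b))"
      unfolding G_def by (rule sum.cong) (use ev that in auto)
    then show ?thesis
      by (simp add: g_def sum_distrib_left mult_ac)
  qed
  have g_sym: "g a b = g b a" if "a < n" "b < n" for a b
  proof -
    have "g a b = G 0 a b" if "b < n" for a b
      unfolding G_def g_def by (rule sum.cong) (use W that in auto)
    then show ?thesis
      using G_sym n that by metis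
  qed
  \<comment> \<open>By symmetry of \<open>G\<close> and \<open>g\<close>, a nonzero
    \<open>g a b\<close> forces equal eigenvalue tuples for \<open>a\<close> and \<open>b\<close>.
    Then columns \<open>a\<close> and \<open>b\<close> of \<open>W\<close> are proportional, which
    contradicts \<open>W'W\<close>.\<close>
  have g0: "g a b = 0" if "a < n" "b < n" "a \<noteq> b" for a b
  proof (rule ccontr)
    assume nz: "g a b \<noteq> 0"
    have eq: "ev i a = ev i b" if "i < n" for i
      using G_sym[of i a b] G_g[of i a b] G_g[of i b a] g_sym[of a b] nz that \<open>a < n\<close> \<open>b < n\<close>
      by simp
    have "W i b * W 0 a = W i a * W 0 b" if "i < n" for i
      using W_ev[of i a] W_ev[of i b] eq that \<open>a < n\<close> \<open>b < n\<close> by simp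
    then have "(\<Sum>i<n. W' a i * W i b) * W 0 a = (\<Sum>i<n. W' a i * W i a) * W 0 b"
      by (simp add: sum_distrib_right mult.assoc)
    then show False
      using W'W[of a b] W'W[of a a] W0[of b] that by simp
  qed
  \<comment> \<open>\<open>W\<close> is recovered from \<open>g\<close>, the matrix
    \<open>Q\<^sup>T W\<close>, by the transpose of \<open>Q'\<close>, and only the diagonal of
    \<open>g\<close> survives.\<close>
  have W_g: "W k b = Q' b k * g b b" if "k < n" "b < n" for k b
  proof -
    have "(\<Sum>a<n. Q' a k * g a b) = (\<Sum>a<n. \<Sum>i<n. Q i a * Q' a k * W i b)"
      unfolding g_def sum_distrib_left by (simp add: mult_ac)
    also have "\<dots> = (\<Sum>i<n. (\<Sum>a<n. Q i a * Q' a k) * W i b)"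
      unfolding sum_distrib_right by (rule sum.swap)
    also have "\<dots> = (\<Sum>i<n. if i = k then W i b else 0)"
      by (rule sum.cong) (use QQ' that in auto)
    also have "\<dots> = W k b"
      using that by simp
    also have "(\<Sum>a<n. Q' a k * g a b) = (\<Sum>a<n. if a = b then Q' a k * g a b else 0)"
      by (rule sum.cong) (use g0 that in auto)
    finally show ?thesis
      using that by simp
  qed
  have g_nz: "g b b \<noteq> 0" if "b < n" for b
    using W0[OF that] W_g[of 0 b] n that by auto
  show thesis
  \<comment> \<open>Inserting \<open>Q Q' = 1\<close> in the last slot gives summands
    \<open>ev i b * W j b * Q' b k\<close>; \<open>W_ev\<close> and \<open>W_g\<close> express
    \<open>ev i b\<close> as \<open>W i b / W 0 b\<close> and \<open>Q' b k\<close> as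
    \<open>W k b / g b b\<close>.\<close>
  proof (rule that[of "\<lambda>b. 1 / (W 0 b * g b b)"])
    show "1 / (W 0 b * g b b) \<noteq> 0" if "b < n" for b
      using W0 g_nz that by simp
  next
    fix i j k
    assume ijk: "i < n" "j < n" "k < n"
    have "t i j k = (\<Sum>k'<n. if k' = k then t i j k' else 0)"
      using ijk by simp
    also have "\<dots> = (\<Sum>k'<n. t i j k' * (\<Sum>b<n. Q k' b * Q' b k))"
      by (rule sum.cong) (use QQ' ijk in auto)
    also have "\<dots> = (\<Sum>b<n. (\<Sum>k'<n. t i j k' * Q k' b) * Q' b k)"
      unfolding sum_distrib_left sum_distrib_right by (subst sum.swap) (simp add: mult.assoc)
    also have "\<dots> = (\<Sum>b<n. 1 / (W 0 b * g b b) * (W i b * W j b * W k b))"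
    proof (rule sum.cong, rule refl)
      fix b assume "b \<in> {..<n}"
      then have b: "b < n"
        by simp
      have "(\<Sum>k'<n. t i j k' * Q k' b) * Q' b k = ev i b * W j b * Q' b k"
        using ev ijk b by simp
      also have "\<dots> = 1 / (W 0 b * g b b) * (W i b * W j b * W k b)"
        using W0[OF b] g_nz[OF b] unfolding W_ev[OF ijk(1) b] W_g[OF ijk(3) b]
        by (simp add: field_simps)
      finally show "(\<Sum>k'<n. t i j k' * Q k' b) * Q' b k =
          1 / (W 0 b * g b b) * (W i b * W j b * W k b)" .
    qed
    finally show "t i j k = (\<Sum>b<n. 1 / (W 0 b * g b b) * (W i b * W j b * W k b))" .
  qed
qed

section \<open>Matrices congruent to diagonal matrices\<close>

definition diagonal_of :: "nat \<Rightarrow> (nat \<Rightarrow> 'a::zero) \<Rightarrow> 'a mat" where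
  "diagonal_of n c = mat n n (\<lambda>(i, j). if i = j then c i else 0)"

lemma diagonal_of_carrier [simp]: "diagonal_of n c \<in> carrier_mat n n"
  by (simp add: diagonal_of_def)

lemma diagonal_mat_diagonal_of: "diagonal_mat (diagonal_of n c)"
  by (simp add: diagonal_of_def diagonal_mat_def)

lemma diagonal_of_mult:
  fixes c d :: "nat \<Rightarrow> 'a::comm_ring_1"
  shows "diagonal_of n c * diagonal_of n d = diagonal_of n (\<lambda>i. c i * d i)"
proof (rule eq_matI)
  fix i j
  assume "i < dim_row (diagonal_of n (\<lambda>i. c i * d i))" "j < dim_col (diagonal_of n (\<lambda>i. c i * d i))"
  then have ij: "i < n" "j < n"
    by (auto simp: diagonal_of_def)
  have "(diagonal_of n c * diagonal_of n d) $$ (i, j) =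
      (\<Sum>k<n. if k = i then (if i = j then c i * d i else 0) else 0)"
    unfolding index_mult_mat_sum[OF diagonal_of_carrier diagonal_of_carrier ij]
    by (rule sum.cong) (use ij in \<open>auto simp: diagonal_of_def\<close>)
  then show "(diagonal_of n c * diagonal_of n d) $$ (i, j) = diagonal_of n (\<lambda>i. c i * d i) $$ (i, j)"
    using ij by (simp add: diagonal_of_def)
qed (simp_all add: diagonal_of_def)

lemma det_diagonal_of: "det (diagonal_of n c) = (\<Prod>i<n. c i :: 'a::comm_ring_1)"
  by (subst det_lower_triangular[of n])
    (auto simp: diagonal_of_def prod_list_diag_prod lessThan_atLeast0 intro!: prod.cong)

text \<open>With \<open>c\<close> a column of \<open>A\<close> the right-hand side is an entry of a
  slice of \<open>cube_sum n A\<close>; with a combination of columns it belongs to the same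
  combination of slices.\<close>

lemma index_congruence_diagonal:
  fixes A :: "'a::comm_ring_1 mat"
  assumes "A \<in> carrier_mat n n" "j < n" "k < n"
  shows "(A\<^sup>T * diagonal_of n c * A) $$ (j, k) = (\<Sum>l<n. c l * A $$ (l, j) * A $$ (l, k))"
proof -
  have "(A\<^sup>T * diagonal_of n c) $$ (j, l) = c l * A $$ (l, j)" if "l < n" for l
  proof -
    have "(A\<^sup>T * diagonal_of n c) $$ (j, l) = (\<Sum>m<n. if m = l then c l * A $$ (l, j) else 0)"
      unfolding index_mult_mat_sum[of "A\<^sup>T" n "diagonal_of n c", simplified, OF assms(1,2) that]
      by (rule sum.cong) (use assms that in \<open>auto simp: diagonal_of_def mult.commute\<close>)
    then show ?thesis
      using that by simp
  qed
  then show ?thesis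
    using assms by (subst index_mult_mat_sum[of _ n]) (auto intro!: sum.cong)
qed

lemma invertible_congruence_diagonal_iff:
  fixes A :: "'a::field mat"
  assumes A: "A \<in> carrier_mat n n" and "invertible_mat A"
  shows "invertible_mat (A\<^sup>T * diagonal_of n c * A) \<longleftrightarrow> (\<forall>l<n. c l \<noteq> 0)"
proof -
  have "A\<^sup>T \<in> carrier_mat n n" "A\<^sup>T * diagonal_of n c \<in> carrier_mat n n"
    using A by (auto intro!: mult_carrier_mat[of _ n n])
  moreover from this have "A\<^sup>T * diagonal_of n c * A \<in> carrier_mat n n"
    using A by (metis mult_carrier_mat)
  moreover have "det A \<noteq> 0"
    using assms invertible_mat_iff_det by blast
  ultimately show ?thesis
    using A by (auto simp: invertible_mat_iff_det det_mult[of _ n] det_transpose det_diagonal_of)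
qed

text \<open>The condition of step (5), for the matrices \<open>X k = T\<^sub>1\<inverse> T\<^sub>k\<close>.\<close>

definition commuting_diagonalizable :: "nat \<Rightarrow> (nat \<Rightarrow> 'a::semiring_1 mat) \<Rightarrow> bool" where
  "commuting_diagonalizable n X \<longleftrightarrow>
     (\<forall>k\<in>{1..<n}. \<forall>l\<in>{1..<n}. X k * X l = X l * X k) \<and> (\<forall>k\<in>{1..<n}. diagonalizable_mat (X k))"

text \<open>All slices are congruent to diagonal matrices by the same \<open>A\<close>, so in
  \<open>T\<^sub>0\<inverse> T\<^sub>k\<close> the factors \<open>A\<^sup>T\<close> cancel and a
  conjugate by \<open>A\<close> of a diagonal matrix of quotients remains.\<close>

lemma commuting_diagonalizable_slices:
  fixes T :: "nat \<Rightarrow> 'a::field mat"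
  assumes T: "\<And>i. T i \<in> carrier_mat n n" and n: "0 < n"
    and A: "A \<in> carrier_mat n n" "invertible_mat A"
    and TA: "\<And>i j k. i < n \<Longrightarrow> j < n \<Longrightarrow> k < n \<Longrightarrow> T i $$ (j, k) = cube_sum n A i j k"
    and U: "U \<in> carrier_mat n n" "U * T 0 = 1\<^sub>m n"
  shows "commuting_diagonalizable n (\<lambda>k. U * T k)"
proof -
  obtain B where B: "B \<in> carrier_mat n n" "A * B = 1\<^sub>m n" "B * A = 1\<^sub>m n"
    using A by (elim invertible_matE)
  have [simp]: "X * Y \<in> carrier_mat n n" if "X \<in> carrier_mat n n" "Y \<in> carrier_mat n n" for X Y
    using that by (rule mult_carrier_mat)
  have mult_assoc: "(X * Y) * Z = X * (Y * Z)"
    if "X \<in> carrier_mat n n" "Y \<in> carrier_mat n n" "Z \<in> carrier_mat n n" for X Y Z :: "'a mat"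
    using that by simp
  note [simp] = T A(1) B(1) U(1)
  have At[simp]: "A\<^sup>T \<in> carrier_mat n n"
    by simp
  have cancel: "A * (B * X) = X" "U * (T 0 * X) = X" if "X \<in> carrier_mat n n" for X
    using that B U by (simp_all add: mult_assoc[symmetric] left_mult_one_mat[of _ n n])
  have T_eq: "T k = A\<^sup>T * diagonal_of n (\<lambda>l. A $$ (l, k)) * A" if "k < n" for k
  proof (rule eq_matI)
    fix i j
    assume "i < dim_row (A\<^sup>T * diagonal_of n (\<lambda>l. A $$ (l, k)) * A)"
      "j < dim_col (A\<^sup>T * diagonal_of n (\<lambda>l. A $$ (l, k)) * A)"
    then have "i < n" "j < n"
      using A by auto
    then show "T k $$ (i, j) = (A\<^sup>T * diagonal_of n (\<lambda>l. A $$ (l, k)) * A) $$ (i, j)"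
      using index_congruence_diagonal[OF A(1)] TA[OF that] by (simp add: cube_sum_def)
  qed (use carrier_matD[OF T[of k]] carrier_matD[OF A(1)] in simp_all)
  have "T 0 * U = 1\<^sub>m n"
    using mat_mult_left_right_inverse[OF U(1) T U(2)] .
  then have "invertible_mat (T 0)"
    using invertible_matI[OF T U(1)] by simp
  \<comment> \<open>Column 0 of \<open>A\<close> is the diagonal belonging to the invertible slice
    0, so the quotients in \<open>D\<close> are genuine.\<close>
  then have A0: "A $$ (l, 0) \<noteq> 0" if "l < n" for l
    using that n unfolding T_eq[OF n] invertible_congruence_diagonal_iff[OF A] by simp
  define D where "D k = diagonal_of n (\<lambda>l. A $$ (l, k) / A $$ (l, 0))" for k
  have [simp]: "D k \<in> carrier_mat n n" for k
    by (simp add: D_def)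
  have "diagonal_of n (\<lambda>l. A $$ (l, 0)) * D k = diagonal_of n (\<lambda>l. A $$ (l, k))" for k
    unfolding D_def diagonal_of_mult using A0
    by (auto simp: diagonal_of_def intro!: eq_matI)
  then have T_D: "T k = T 0 * (B * D k * A)" if "k < n" for k
    using T_eq[OF that] unfolding T_eq[OF n]
    by (simp add: mult_assoc cancel) (simp add: mult_assoc[symmetric])
  have UT: "U * T k = B * D k * A" if "k < n" for k
    by (subst T_D[OF that]) (simp add: cancel)
  have "D k * D l = D l * D k" for k l
    by (simp add: D_def diagonal_of_mult mult.commute)
  then have "(B * D k * A) * (B * D l * A) = (B * D l * A) * (B * D k * A)" for k l
    by (simp add: mult_assoc cancel) (simp add: mult_assoc[symmetric])
  moreover have "diagonalizable_mat (B * D k * A)" for k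
    unfolding diagonalizable_mat_def
    by (intro exI[of _ "D k"] conjI similar_matI[of _ _ B A n])
      (auto simp: B D_def diagonal_mat_diagonal_of)
  ultimately show ?thesis
    by (simp add: commuting_diagonalizable_def UT)
qed

text \<open>A basis of joint eigenvectors gives a decomposition into weighted tensor cubes; cube
  roots absorb the weights.\<close>

lemma cube_sum_if_commuting_diagonalizable:
  fixes T :: "nat \<Rightarrow> 'a::field mat"
  assumes T: "\<And>i. T i \<in> carrier_mat n n" and n: "0 < n"
    and sym: "symmetric3 n (\<lambda>i j k. T i $$ (j, k))"
    and U: "U \<in> carrier_mat n n" "U * T 0 = 1\<^sub>m n"
    and comm: "commuting_diagonalizable n (\<lambda>k. U * T k)"
    and cube_root: "\<And>x :: 'a. \<exists>y. y ^ 3 = x"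
  shows "\<exists>A\<in>carrier_mat n n. invertible_mat A \<and>
    (\<forall>i<n. \<forall>j<n. \<forall>k<n. T i $$ (j, k) = cube_sum n A i j k)"
proof -
  have [simp]: "X * Y \<in> carrier_mat n n" if "X \<in> carrier_mat n n" "Y \<in> carrier_mat n n" for X Y
    using that by (rule mult_carrier_mat)
  have mult_assoc: "(X * Y) * Z = X * (Y * Z)"
    if "X \<in> carrier_mat n n" "Y \<in> carrier_mat n n" "Z \<in> carrier_mat n n" for X Y Z :: "'a mat"
    using that by simp
  note [simp] = T U(1)
  have T0U: "T 0 * U = 1\<^sub>m n"
    using mat_mult_left_right_inverse[OF U(1) T U(2)] .
  obtain Q where Q[simp]: "Q \<in> carrier_mat n n" and "invertible_mat Q"
    and Q_eig: "\<forall>b<n. \<forall>k\<in>{1..<n}. \<exists>c. (U * T k) *\<^sub>v col Q b = c \<cdot>\<^sub>v col Q b"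
    using joint_eigenvector_basis[of "{1..<n}" "\<lambda>k. U * T k" n] comm
    unfolding commuting_diagonalizable_def by auto
  then obtain Q' where Q'[simp]: "Q' \<in> carrier_mat n n" and QQ': "Q * Q' = 1\<^sub>m n" "Q' * Q = 1\<^sub>m n"
    by (metis invertible_matE)
  define W where "W = T 0 * Q"
  define W' where "W' = Q' * U"
  have [simp]: "W \<in> carrier_mat n n" "W' \<in> carrier_mat n n"
    by (simp_all add: W_def W'_def)
  have "W' * W = Q' * ((U * T 0) * Q)"
    by (simp add: W_def W'_def mult_assoc)
  then have W'W: "W' * W = 1\<^sub>m n"
    by (simp add: U QQ' left_mult_one_mat[of _ n n])
  \<comment> \<open>The hypothesis covers only the slices from index 1 on; slice 0 has the
    eigenvalue 1 at every column.\<close>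
  have "\<exists>c. \<forall>j<n. (\<Sum>k<n. T i $$ (j, k) * Q $$ (k, b)) = c * W $$ (j, b)" if "i < n" "b < n" for i b
  proof (cases "i = 0")
    case True
    then show ?thesis
      using that by (intro exI[of _ 1]) (simp add: W_def index_mult_mat_sum[of _ n])
  next
    case False
    have q: "col Q b \<in> carrier_vec n"
      using Q that by (metis col_carrier_vec)
    have "i \<in> {1..<n}"
      using False that by simp
    then obtain c where c: "(U * T i) *\<^sub>v col Q b = c \<cdot>\<^sub>v col Q b"
      using Q_eig \<open>b < n\<close> by blast
    \<comment> \<open>Inserting \<open>T 0 * U\<close> makes the eigenvalue equation of
      \<open>U * T i\<close> a relation between the slices \<open>T i\<close> and
      \<open>T 0\<close>.\<close>
    have "T i *\<^sub>v col Q b = (T 0 * U * T i) *\<^sub>v col Q b"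
      by (simp add: T0U left_mult_one_mat[of _ n n])
    also have "\<dots> = T 0 *\<^sub>v ((U * T i) *\<^sub>v col Q b)"
      using q by (simp add: mult_assoc assoc_mult_mat_vec[of _ n n _ n])
    also have "\<dots> = c \<cdot>\<^sub>v (T 0 *\<^sub>v col Q b)"
      unfolding c using q by (simp add: mult_mat_vec[of _ n n])
    finally have eq: "T i *\<^sub>v col Q b = c \<cdot>\<^sub>v (T 0 *\<^sub>v col Q b)" .
    have "(\<Sum>k<n. T i $$ (j, k) * Q $$ (k, b)) = c * W $$ (j, b)" if j: "j < n" for j
    proof -
      have *: "(T m *\<^sub>v col Q b) $ j = (\<Sum>k<n. T m $$ (j, k) * Q $$ (k, b))" for m
        using index_mult_mat_vec_sum[OF T q j, of m] \<open>b < n\<close> carrier_matD[OF Q] by simp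
      have "(\<Sum>k<n. T i $$ (j, k) * Q $$ (k, b)) = c * (T 0 *\<^sub>v col Q b) $ j"
        using arg_cong[OF eq, of "\<lambda>v. v $ j"] j carrier_matD[OF T[of 0]] unfolding *[symmetric] by simp
      then show ?thesis
        unfolding * W_def using j \<open>b < n\<close> by (simp add: index_mult_mat_sum[of _ n])
    qed
    then show ?thesis
      by blast
  qed
  then obtain ev where ev: "(\<Sum>k<n. T i $$ (j, k) * Q $$ (k, b)) = ev i b * W $$ (j, b)"
    if "i < n" "b < n" "j < n" for i j b
    by metis
  obtain d where d: "\<And>b. b < n \<Longrightarrow> d b \<noteq> 0"
    "\<And>i j k. i < n \<Longrightarrow> j < n \<Longrightarrow> k < n \<Longrightarrow>
       T i $$ (j, k) = (\<Sum>b<n. d b * (W $$ (i, b) * W $$ (j, b) * W $$ (k, b)))"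
  proof (rule tensor_decomposition[OF sym n, of "\<lambda>i j. Q $$ (i, j)" "\<lambda>i j. Q' $$ (i, j)"
        "\<lambda>i j. W' $$ (i, j)" "\<lambda>i j. W $$ (i, j)" ev])
    show "(\<Sum>b<n. Q $$ (i, b) * Q' $$ (b, j)) = of_bool (i = j)" if "i < n" "j < n" for i j
      using that by (simp add: index_mult_mat_sum[OF Q Q' that, symmetric] QQ')
    show "(\<Sum>i<n. W' $$ (a, i) * W $$ (i, b)) = of_bool (a = b)" if "a < n" "b < n" for a b
      using that by (simp add: index_mult_mat_sum[of W' n W a b, symmetric] W'W)
    show "W $$ (i, b) = (\<Sum>k<n. T 0 $$ (i, k) * Q $$ (k, b))" if "i < n" "b < n" for i b
      using that by (simp add: W_def index_mult_mat_sum[of _ n])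
  qed (use ev in blast)+
  define r where "r b = (SOME y. y ^ 3 = d b)" for b
  have r: "r b ^ 3 = d b" for b
    unfolding r_def using cube_root by (rule someI_ex)
  have r_nz: "r b \<noteq> 0" if "b < n" for b
    using d(1)[OF that] r[of b] by auto
  \<comment> \<open>Row \<open>b\<close> of \<open>A\<close> is column \<open>b\<close> of
    \<open>W\<close> scaled by a cube root of \<open>d b\<close>; rescaling the transpose of
    \<open>W'\<close> inverts it.\<close>
  define A where "A = mat n n (\<lambda>(b, i). r b * W $$ (i, b))"
  define A' where "A' = mat n n (\<lambda>(i, b). W' $$ (b, i) / r b)"
  have A: "A \<in> carrier_mat n n" "A' \<in> carrier_mat n n"
    by (simp_all add: A_def A'_def)
  have "A * A' = 1\<^sub>m n"
  proof (rule eq_matI)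
    fix b c assume "b < dim_row (1\<^sub>m n :: 'a mat)" "c < dim_col (1\<^sub>m n :: 'a mat)"
    then have bc: "b < n" "c < n"
      by auto
    have "(A * A') $$ (b, c) = (\<Sum>i<n. W' $$ (c, i) * W $$ (i, b)) * (r b / r c)"
      unfolding index_mult_mat_sum[OF A bc] sum_distrib_right
      by (rule sum.cong) (use bc in \<open>auto simp: A_def A'_def\<close>)
    also have "\<dots> = 1\<^sub>m n $$ (c, b) * (r b / r c)"
      using bc by (simp add: index_mult_mat_sum[of W' n W c b, symmetric] W'W)
    also have "\<dots> = 1\<^sub>m n $$ (b, c)"
      using bc r_nz by auto
    finally show "(A * A') $$ (b, c) = 1\<^sub>m n $$ (b, c)" .
  qed (use A in auto)
  then have "invertible_mat A"
    using A invertible_matI by blast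
  moreover have "T i $$ (j, k) = cube_sum n A i j k" if "i < n" "j < n" "k < n" for i j k
    unfolding d(2)[OF that] cube_sum_def
    by (rule sum.cong) (use that in \<open>auto simp: A_def r[symmetric] power3_eq_cube mult_ac\<close>)
  ultimately show ?thesis
    using A by blast
qed

section \<open>Change of variables in tensors\<close>

lemma transform3_cube_sum:
  assumes "A \<in> carrier_mat n n" "R \<in> carrier_mat n n" "i < n" "j < n" "k < n"
  shows "transform3 n R (cube_sum n A) i j k = cube_sum n (A * R) i j k"
proof -
  \<comment> \<open>Contracting one slot replaces one factor \<open>A\<close> by
    \<open>A * R\<close>; the weights \<open>x\<close> stand for the other two factors, so this
    serves for all three slots.\<close>
  have contract: "(\<Sum>c<n. R $$ (c, m) * (\<Sum>l<n. x l * A $$ (l, c))) = (\<Sum>l<n. x l * (A * R) $$ (l, m))"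
    if "m < n" for m x
  proof -
    have "(\<Sum>c<n. R $$ (c, m) * (\<Sum>l<n. x l * A $$ (l, c))) =
        (\<Sum>l<n. \<Sum>c<n. R $$ (c, m) * (x l * A $$ (l, c)))"
      unfolding sum_distrib_left by (rule sum.swap)
    also have "\<dots> = (\<Sum>l<n. x l * (A * R) $$ (l, m))"
      by (rule sum.cong)
        (use assms(1,2) that in
          \<open>simp_all add: index_mult_mat_sum[of _ n] sum_distrib_left mult_ac del: index_mult_mat\<close>)
    finally show ?thesis .
  qed
  have "transform3 n R (cube_sum n A) i j k =
      (\<Sum>a<n. R $$ (a, i) * (\<Sum>b<n. R $$ (b, j) *
        (\<Sum>l<n. A $$ (l, a) * A $$ (l, b) * (A * R) $$ (l, k))))"
    unfolding transform3_def cube_sum_def contract[OF assms(5)] ..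
  also have "\<dots> = (\<Sum>a<n. R $$ (a, i) * (\<Sum>b<n. R $$ (b, j) *
      (\<Sum>l<n. (A $$ (l, a) * (A * R) $$ (l, k)) * A $$ (l, b))))"
    by (simp only: mult_ac)
  also have "\<dots> = (\<Sum>a<n. R $$ (a, i) * (\<Sum>l<n. ((A * R) $$ (l, k) * (A * R) $$ (l, j)) * A $$ (l, a)))"
    unfolding contract[OF assms(4)] by (simp only: mult_ac)
  also have "\<dots> = cube_sum n (A * R) i j k"
    unfolding contract[OF assms(3)] cube_sum_def by (simp only: mult_ac)
  finally show ?thesis .
qed

text \<open>Contraction with \<open>R'\<close> undoes the one with \<open>R\<close>, one slot after
  the other. This carries a decomposition of the transformed form back to the original one.\<close>

lemma transform3_inj:
  fixes t t' :: "nat \<Rightarrow> nat \<Rightarrow> nat \<Rightarrow> 'a::comm_ring_1"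
  assumes R: "R \<in> carrier_mat n n" "R' \<in> carrier_mat n n" "R * R' = 1\<^sub>m n"
    and eq: "\<And>i j k. i < n \<Longrightarrow> j < n \<Longrightarrow> k < n \<Longrightarrow> transform3 n R t i j k = transform3 n R t' i j k"
    and "a < n" "b < n" "c < n"
  shows "t a b c = t' a b c"
proof -
  have cancel: "x c = y c"
    if "\<And>i. i < n \<Longrightarrow> (\<Sum>a<n. R $$ (a, i) * x a) = (\<Sum>a<n. R $$ (a, i) * y a)" "c < n" for x y c
  proof -
    have "(\<Sum>i<n. R' $$ (i, c) * (\<Sum>a<n. R $$ (a, i) * x a)) = x c" for x
    proof -
      have "(\<Sum>i<n. R' $$ (i, c) * (\<Sum>a<n. R $$ (a, i) * x a)) =
          (\<Sum>a<n. \<Sum>i<n. R' $$ (i, c) * (R $$ (a, i) * x a))"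
        unfolding sum_distrib_left by (rule sum.swap)
      also have "\<dots> = (\<Sum>a<n. (R * R') $$ (a, c) * x a)"
        by (rule sum.cong)
          (use R(1,2) that(2) in
            \<open>simp_all add: index_mult_mat_sum[of _ n] sum_distrib_left sum_distrib_right mult_ac
              del: index_mult_mat\<close>)
      also have "\<dots> = (\<Sum>a<n. if a = c then x a else 0)"
        by (rule sum.cong) (use R(3) that(2) in auto)
      finally show ?thesis
        using that(2) by simp
    qed
    then show ?thesis
      using that(1) by (metis (no_types, lifting) lessThan_iff sum.cong)
  qed
  show ?thesis
    by (intro cancel[of "t a b" "t' a b" c]
        cancel[of "\<lambda>b. \<Sum>c<n. R $$ (c, _) * t a b c" "\<lambda>b. \<Sum>c<n. R $$ (c, _) * t' a b c" b]
        cancel[of "\<lambda>a. \<Sum>b<n. R $$ (b, _) * (\<Sum>c<n. R $$ (c, _) * t a b c)"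
          "\<lambda>a. \<Sum>b<n. R $$ (b, _) * (\<Sum>c<n. R $$ (c, _) * t' a b c)" a])
      (use eq assms(5-) in \<open>auto simp: transform3_def\<close>)
qed

subsection \<open>The procedure\<close>

lemma change_mat_carrier [simp]: "change_mat n r \<in> carrier_mat n n"
  by (simp add: change_mat_def)

lemma invertible_change_mat: "invertible_mat (change_mat n r :: 'a::field mat)"
proof -
  have "det (change_mat n r :: 'a mat) = (\<Prod>i<n. 1)"
    by (subst det_lower_triangular[of n])
      (auto simp: change_mat_def prod_list_diag_prod lessThan_atLeast0 intro!: prod.cong)
  then show ?thesis
    by (simp add: invertible_mat_iff_det[of _ n])
qed

lemma slice_comb_carrier [simp]: "slice_comb n f r \<in> carrier_mat n n"
  by (simp add: slice_comb_def)

text \<open>As \<open>r $ 0 = 1\<close>, the unweighted slice 0 becomes the term of index 0 in a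
  uniform sum.\<close>

lemma index_slice_comb:
  assumes "r $ 0 = 1" "j < n" "k < n"
  shows "slice_comb n f r $$ (j, k) = (\<Sum>i<n. r $ i * slice_tensor n f i j k)"
proof -
  have "{..<n} = insert 0 {1..<n}"
    using assms(2) by auto
  then show ?thesis
    using assms by (simp add: slice_comb_def slice_tensor_def carrier_matD[OF slice_carrier])
qed

lemma slice_comb_cube_sum:
  assumes "r $ 0 = 1" "A \<in> carrier_mat n n"
    and "\<And>i j k. i < n \<Longrightarrow> j < n \<Longrightarrow> k < n \<Longrightarrow> slice_tensor n f i j k = cube_sum n A i j k"
  shows "slice_comb n f r = A\<^sup>T * diagonal_of n (\<lambda>l. \<Sum>i<n. r $ i * A $$ (l, i)) * A"
proof (rule eq_matI)
  fix j k
  assume "j < dim_row (A\<^sup>T * diagonal_of n (\<lambda>l. \<Sum>i<n. r $ i * A $$ (l, i)) * A)"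
    "k < dim_col (A\<^sup>T * diagonal_of n (\<lambda>l. \<Sum>i<n. r $ i * A $$ (l, i)) * A)"
  then have jk: "j < n" "k < n"
    using assms(2) by auto
  have "slice_comb n f r $$ (j, k) = (\<Sum>i<n. \<Sum>l<n. r $ i * (A $$ (l, i) * A $$ (l, j) * A $$ (l, k)))"
    unfolding index_slice_comb[where f = f, OF assms(1) jk]
    by (rule sum.cong) (use assms(3) jk in \<open>auto simp: cube_sum_def sum_distrib_left\<close>)
  also have "\<dots> = (\<Sum>l<n. (\<Sum>i<n. r $ i * A $$ (l, i)) * A $$ (l, j) * A $$ (l, k))"
    by (subst sum.swap) (simp add: sum_distrib_right mult.assoc)
  also have "\<dots> = (A\<^sup>T * diagonal_of n (\<lambda>l. \<Sum>i<n. r $ i * A $$ (l, i)) * A) $$ (j, k)"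
    by (rule index_congruence_diagonal[OF assms(2) jk, symmetric])
  finally show "slice_comb n f r $$ (j, k) = \<dots>" .
qed (use assms(2) carrier_matD[OF slice_comb_carrier[of n f r]] in auto)

text \<open>Column 0 of \<open>R\<close> is \<open>r\<close>, so contracting the first slot at index
  0 yields the combination of slices; the other two slots yield the congruence.\<close>

lemma slice_0_change_mat:
  fixes f :: "'a::field_char_0 mpoly"
  assumes f: "f \<in> polys_in n" "homogeneous 3 f" and r: "r $ 0 = 1"
  defines "R \<equiv> change_mat n r"
  shows "slice n (lin_subst R f) 0 = R\<^sup>T * slice_comb n f r * R"
proof (rule eq_matI)
  have R: "R \<in> carrier_mat n n" "R\<^sup>T \<in> carrier_mat n n"
    by (simp_all add: R_def)
  fix j k
  assume "j < dim_row (R\<^sup>T * slice_comb n f r * R)" "k < dim_col (R\<^sup>T * slice_comb n f r * R)"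
  then have jk: "j < n" "k < n"
    using R by auto
  let ?S = "slice_tensor n f"
  have "slice n (lin_subst R f) 0 $$ (j, k) =
      (\<Sum>a<n. r $ a * (\<Sum>b<n. R $$ (b, j) * (\<Sum>c<n. R $$ (c, k) * ?S a b c)))"
  proof -
    have "slice n (lin_subst R f) 0 $$ (j, k) = transform3 n R ?S 0 j k"
      using slice_tensor_lin_subst[OF f R(1), of 0 j k] jk by (simp add: slice_tensor_def)
    also have "\<dots> = (\<Sum>a<n. r $ a * (\<Sum>b<n. R $$ (b, j) * (\<Sum>c<n. R $$ (c, k) * ?S a b c)))"
      unfolding transform3_def by (rule sum.cong) (use r jk in \<open>auto simp: R_def change_mat_def\<close>)
    finally show ?thesis .
  qed
  also have "\<dots> = (\<Sum>b<n. \<Sum>a<n. \<Sum>c<n. r $ a * (R $$ (b, j) * (R $$ (c, k) * ?S a b c)))"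
    unfolding sum_distrib_left by (rule sum.swap)
  also have "\<dots> = (\<Sum>b<n. \<Sum>c<n. \<Sum>a<n. r $ a * (R $$ (b, j) * (R $$ (c, k) * ?S a b c)))"
    by (intro sum.cong refl sum.swap)
  also have "\<dots> = (\<Sum>c<n. \<Sum>b<n. \<Sum>a<n. r $ a * (R $$ (b, j) * (R $$ (c, k) * ?S a b c)))"
    by (rule sum.swap)
  also have "\<dots> = (\<Sum>c<n. \<Sum>b<n. R $$ (b, j) * slice_comb n f r $$ (b, c) * R $$ (c, k))"
    by (intro sum.cong refl)
      (simp add: index_slice_comb[OF r] sum_distrib_left sum_distrib_right mult_ac)
  also have "\<dots> = (R\<^sup>T * slice_comb n f r * R) $$ (j, k)"
  proof -
    have "(R\<^sup>T * slice_comb n f r) $$ (j, c) = (\<Sum>b<n. R $$ (b, j) * slice_comb n f r $$ (b, c))"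
      if "c < n" for c
      using that jk R by (simp add: index_mult_mat_sum[of _ n] del: index_mult_mat)
    then show ?thesis
      unfolding index_mult_mat_sum[OF mult_carrier_mat[OF R(2) slice_comb_carrier] R(1) jk]
      by (simp add: sum_distrib_right)
  qed
  finally show "slice n (lin_subst R f) 0 $$ (j, k) = (R\<^sup>T * slice_comb n f r * R) $$ (j, k)" .
next
  show "dim_row (slice n (lin_subst R f) 0) = dim_row (R\<^sup>T * slice_comb n f r * R)"
    "dim_col (slice n (lin_subst R f) 0) = dim_col (R\<^sup>T * slice_comb n f r * R)"
    by (simp_all add: R_def slice_def change_mat_def)
qed

lemma invertible_slice_0_change_mat_iff:
  fixes f :: "'a::field_char_0 mpoly"
  assumes "f \<in> polys_in n" "homogeneous 3 f" "r $ 0 = 1"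
  shows "invertible_mat (slice n (lin_subst (change_mat n r) f) 0) \<longleftrightarrow> invertible_mat (slice_comb n f r)"
proof -
  let ?R = "change_mat n r" and ?D = "slice_comb n f r"
  have "?R\<^sup>T \<in> carrier_mat n n" "?R\<^sup>T * ?D \<in> carrier_mat n n"
    by (auto intro!: mult_carrier_mat[of _ n n])
  moreover from this have "?R\<^sup>T * ?D * ?R \<in> carrier_mat n n"
    using change_mat_carrier by (metis mult_carrier_mat)
  moreover have "det ?R \<noteq> 0"
    using invertible_change_mat invertible_mat_iff_det change_mat_carrier by blast
  ultimately show ?thesis
    unfolding slice_0_change_mat[OF assms]
    by (auto simp: invertible_mat_iff_det[of _ n] det_mult[of _ n] det_transpose[of _ n])
qed

text \<open>\<open>D\<^sub>1\<close> is singular at \<open>\<gamma>(t)\<close> only if \<open>t\<close> is a root of one of the \<open>n\<close> nonzero polynomials of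
  degree less than \<open>n\<close> whose coefficients are the rows of \<open>A\<close>.\<close>

lemma invertible_slice_comb_exists:
  fixes f :: "'a::field_char_0 mpoly"
  assumes n: "0 < n" and A: "A \<in> carrier_mat n n" "invertible_mat A"
    and S: "\<And>i j k. i < n \<Longrightarrow> j < n \<Longrightarrow> k < n \<Longrightarrow> slice_tensor n f i j k = cube_sum n A i j k"
    and M: "M \<subseteq> range (moment_curve n)" "card M = n * (n - 1) + 1"
  shows "\<exists>r\<in>M. invertible_mat (slice_comb n f r)"
proof (rule ccontr)
  assume contra: "\<not> ?thesis"
  obtain B where B: "B \<in> carrier_mat n n" "A * B = 1\<^sub>m n"
    using A by (elim invertible_matE)
  define p where "p l = (\<Sum>i<n. monom (A $$ (l, i)) i)" for l
  have coeff_p: "poly.coeff (p l) i = A $$ (l, i)" if "i < n" for l i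
    using that by (simp add: p_def coeff_sum)
  have "p l \<noteq> 0" if "l < n" for l
  proof
    assume "p l = 0"
    then have "(\<Sum>k<n. A $$ (l, k) * B $$ (k, l)) = 0"
      using coeff_p by (intro sum.neutral) (metis coeff_0 lessThan_iff mult_zero_left)
    then show False
      using that by (simp add: index_mult_mat_sum[OF A(1) B(1), symmetric] B(2) del: index_mult_mat)
  qed
  \<comment> \<open>No row of the invertible \<open>A\<close> vanishes, so no factor does.\<close>
  then have nz: "(\<Prod>l<n. p l) \<noteq> 0"
    by simp
  have "degree (p l) \<le> n - 1" for l
    unfolding p_def by (rule degree_sum_le) (auto intro: order.trans[OF degree_monom_le])
  \<comment> \<open>There are \<open>n\<close> factors of degree at most \<open>n - 1\<close>, hence
    one root fewer than \<open>M\<close> has points.\<close>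
  then have deg: "degree (\<Prod>l<n. p l) \<le> n * (n - 1)"
    using order.trans[OF degree_prod_sum_le[of "{..<n}" p]]
      sum_bounded_above[of "{..<n}" "degree \<circ> p" "n - 1"]
    by simp
  let ?Z = "{x. poly (\<Prod>l<n. p l) x = 0}"
  have "M \<subseteq> moment_curve n ` ?Z"
  proof
    fix r assume "r \<in> M"
    then obtain x where r: "r = moment_curve n x" and "\<not> invertible_mat (slice_comb n f r)"
      using M(1) contra by auto
    then have "\<not> (\<forall>l<n. (\<Sum>i<n. r $ i * A $$ (l, i)) \<noteq> 0)"
      using slice_comb_cube_sum[OF _ A(1) S, of r] invertible_congruence_diagonal_iff[OF A] n
      by (simp add: moment_curve_def)
    then obtain l where "l < n" "(\<Sum>i<n. r $ i * A $$ (l, i)) = 0"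
      by auto
    moreover have "poly (p l) x = (\<Sum>i<n. r $ i * A $$ (l, i))"
      by (simp add: p_def poly_sum poly_monom r moment_curve_def mult.commute)
    ultimately have "x \<in> ?Z"
      by (auto simp: poly_prod)
    then show "r \<in> moment_curve n ` ?Z"
      using r by blast
  qed
  moreover have "finite ?Z"
    using nz by (rule poly_roots_finite)
  ultimately have "card M \<le> card ?Z"
    by (meson card_image_le card_mono finite_imageI order.trans)
  also have "\<dots> \<le> n * (n - 1)"
    using card_poly_roots_bound[OF nz] deg by simp
  finally show False
    using M(2) by simp
qed

text \<open>If a point is found, \<open>R\<close> is invertible and both sides are compared through
  the slices of the transformed form: \<open>A\<close> decomposes the tensor of \<open>f\<close>
  exactly if \<open>A * R\<close> decomposes the new one.\<close>

lemma accepts_iff_equiv_sum_of_cubes: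
  fixes f :: "'a::field_char_0 mpoly"
  assumes n: "0 < n" and f: "f \<in> polys_in n" "homogeneous 3 f"
    and M: "M \<subseteq> range (moment_curve n)" "card M = n * (n - 1) + 1" and ms: "set ms = M"
    and cube_root: "\<And>x :: 'a. \<exists>y. y ^ 3 = x"
  shows "accepts n ms f \<longleftrightarrow> equiv_sum_of_cubes n f"
proof (cases "find (\<lambda>r. invertible_mat (slice_comb n f r)) ms")
  case None
  then have "\<not> (\<exists>r\<in>M. invertible_mat (slice_comb n f r))"
    using ms by (simp add: find_None_iff)
  then have "\<not> equiv_sum_of_cubes n f"
    using invertible_slice_comb_exists[OF n _ _ _ M, of _ f] unfolding equiv_sum_of_cubes_iff[OF f]
    by blast
  then show ?thesis
    using None by (simp add: accepts_def)
next
  case (Some r)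
  then have inv: "invertible_mat (slice_comb n f r)" and "r \<in> M"
    using ms by (auto simp: find_Some_iff)
  then have r0: "r $ 0 = 1"
    using M(1) n by (auto simp: moment_curve_def)
  define R where "R = change_mat n r"
  define T where "T = slice n (lin_subst R f)"
  define U where "U = the (mat_inverse (T 0))"
  have accepts: "accepts n ms f \<longleftrightarrow> commuting_diagonalizable n (\<lambda>k. U * T k)"
    using Some by (simp add: accepts_def Let_def commuting_diagonalizable_def R_def T_def U_def)
  have R: "R \<in> carrier_mat n n" and T: "T k \<in> carrier_mat n n" for k
    by (simp_all add: R_def T_def)
  obtain R' where R': "R' \<in> carrier_mat n n" "R * R' = 1\<^sub>m n" "R' * R = 1\<^sub>m n"
    using R invertible_change_mat[of n r] unfolding R_def[symmetric] by (elim invertible_matE)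
  have "invertible_mat (T 0)"
    using inv invertible_slice_0_change_mat_iff[OF f r0] by (simp add: T_def R_def)
  then have "det (T 0) \<noteq> 0"
    by (simp add: invertible_mat_iff_det[OF T])
  \<comment> \<open>This rules out the result \<open>None\<close> of \<open>mat_inverse\<close>, so
    that \<open>U\<close> is the inverse of \<open>T 0\<close>.\<close>
  then have "T 0 \<in> Units (ring_mat TYPE('a) n ())"
    by (rule det_non_zero_imp_unit[OF T])
  then obtain V where "mat_inverse (T 0) = Some V"
    using mat_inverse(1)[OF T] by fast
  then have U: "U \<in> carrier_mat n n" "U * T 0 = 1\<^sub>m n"
    using mat_inverse(2)[OF T] by (simp_all add: U_def)
  have T_S: "T i $$ (j, k) = transform3 n R (slice_tensor n f) i j k"
    if "i < n" "j < n" "k < n" for i j k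
    using slice_tensor_lin_subst[OF f R that] by (simp add: slice_tensor_def T_def)
  show ?thesis
  proof
    assume "accepts n ms f"
    moreover have "symmetric3 n (\<lambda>i j k. T i $$ (j, k))"
      using symmetric3_slice_tensor[of n "lin_subst R f"] unfolding T_def slice_tensor_def .
    ultimately obtain C where C: "C \<in> carrier_mat n n" "invertible_mat C"
      "\<forall>i<n. \<forall>j<n. \<forall>k<n. T i $$ (j, k) = cube_sum n C i j k"
      using cube_sum_if_commuting_diagonalizable[of T n U, OF T n _ U _ cube_root] accepts by blast
    obtain C' where C': "C' \<in> carrier_mat n n" "C * C' = 1\<^sub>m n"
      using C by (elim invertible_matE)
    \<comment> \<open>\<open>C\<close> decomposes the transformed tensor; multiplying by the inverse
      of \<open>R\<close> returns to the original variables.\<close>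
    define A where "A = C * R'"
    have A: "A \<in> carrier_mat n n" "R * C' \<in> carrier_mat n n"
      unfolding A_def using C(1) C'(1) R R'(1) by (metis mult_carrier_mat)+
    have "A * R = C"
      using assoc_mult_mat[OF C(1) R'(1) R] R' C(1) by (simp add: A_def)
    then have "A * (R * C') = 1\<^sub>m n"
      using assoc_mult_mat[OF A(1) R C'(1)] C' by simp
    then have "invertible_mat A"
      using A invertible_matI by blast
    moreover have "slice_tensor n f i j k = cube_sum n A i j k" if "i < n" "j < n" "k < n" for i j k
      by (rule transform3_inj[OF R R'(1,2) _ that])
        (use C(3) T_S transform3_cube_sum[OF A(1) R] \<open>A * R = C\<close> in auto)
    ultimately show "equiv_sum_of_cubes n f"
      unfolding equiv_sum_of_cubes_iff[OF f] using A by blast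
  next
    assume "equiv_sum_of_cubes n f"
    then obtain A where A: "A \<in> carrier_mat n n" "invertible_mat A"
      "\<And>i j k. i < n \<Longrightarrow> j < n \<Longrightarrow> k < n \<Longrightarrow> slice_tensor n f i j k = cube_sum n A i j k"
      unfolding equiv_sum_of_cubes_iff[OF f] by blast
    have AR: "A * R \<in> carrier_mat n n"
      using A(1) R by (metis mult_carrier_mat)
    moreover have "invertible_mat (A * R)"
      using A R AR invertible_change_mat[of n r] det_mult[OF A(1) R]
      by (simp add: invertible_mat_iff_det[of _ n] R_def)
    moreover have "T i $$ (j, k) = cube_sum n (A * R) i j k" if "i < n" "j < n" "k < n" for i j k
    proof -
      have "transform3 n R (slice_tensor n f) i j k = transform3 n R (cube_sum n A) i j k"
        unfolding transform3_def by (intro sum.cong refl arg_cong2[where f = "(*)"]) (use A(3) in auto)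
      then show ?thesis
        using T_S transform3_cube_sum[OF A(1) R] that by simp
    qed
    ultimately show "accepts n ms f"
      unfolding accepts using commuting_diagonalizable_slices[of T n "A * R" U, OF T n _ _ _ U] by blast
  qed
qed

section \<open>Cube roots and the two base fields\<close>

lemma real_cube_root_exists: "\<exists>y. y ^ 3 = (x :: real)"
  by (intro exI[of _ "root 3 x"] odd_real_root_pow) simp

lemma complex_cube_root_exists: "\<exists>y. y ^ 3 = (z :: complex)"
  by (intro exI[of _ "rcis (root 3 (cmod z)) (Arg z / 3)"]) (simp add: DeMoivre2 rcis_cmod_Arg)

theorem theorem5p3:
  fixes n :: nat
  assumes "n \<ge> 1"
  shows "(\<forall>(f :: real mpoly) (M :: real vec set) ms.
            f \<in> polys_in n \<and> homogeneous 3 f \<and>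
            M \<subseteq> range (moment_curve n) \<and> card M = n * (n - 1) + 1 \<and>
            distinct ms \<and> set ms = M \<longrightarrow>
            (accepts n ms f \<longleftrightarrow> equiv_sum_of_cubes n f)) \<and>
         (\<forall>(f :: complex mpoly) (M :: complex vec set) ms.
            f \<in> polys_in n \<and> homogeneous 3 f \<and>
            M \<subseteq> range (moment_curve n) \<and> card M = n * (n - 1) + 1 \<and>
            distinct ms \<and> set ms = M \<longrightarrow>
            (accepts n ms f \<longleftrightarrow> equiv_sum_of_cubes n f))"
  using accepts_iff_equiv_sum_of_cubes[of n "_ :: real mpoly", OF _ _ _ _ _ _ real_cube_root_exists]
    accepts_iff_equiv_sum_of_cubes[of n "_ :: complex mpoly", OF _ _ _ _ _ _ complex_cube_root_exists]
    assms
  by auto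

end
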